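(* Let $w$ be a finite word and let $(<_A,<_D)$ be a pair of strict total orders on its alphabet with $<_D$ the reverse of $<_A$. Then $w$ is included in the natural coding of a standard symmetric interval exchange transformation with orders $(<_A,<_D)$ if and only if $F(w)$ satisfies the order condition for $(<_A,<_D)$.
   Context: $F(w)$ is the set of all factors of $w$. In a factor-closed set $L$ of words, $v$ is bispecial if at least two letters $x$ have $xv\in L$ and at least two letters $y$ have $vy\in L$; a bispecial $v$ satisfies the order condition for $(<_A,<_D)$ if whenever $xvy,x'vy'\in L$ with letters $x\ne x'$, $y\ne y'$, then $x<_Ax'$ iff $y<_Dy'$; $L$ satisfies the order condition if all its bispecials (including the empty word) do. All intervals are closed on the left and open on the right. A standard interval exchange transformation is a map $T$ on an interval $I$ with a partition into intervals $I_e$, $e\in\mathcal A$, $T$ a translation on each $I_e$, the $TI_e$ partitioning $I$; its orders: $e<_Df$ iff $I_e$ is strictly left of $I_f$, $e<_Af$ iff $TI_e$ is strictly left of $TI_f$; it is symmetric if these orders are reverses of each other. Its natural coding is the set of finite factors of the sequences $(x_n)_{n\in\mathbb Z}$, $x\in I$, with $x_n=e$ iff $T^nx\in I_e$. *)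

theory Defs
  imports Complex_Main "HOL-Library.Sublist" "HOL-Library.Disjoint_Sets"
begin

definition strict_total_order_on :: "'a set \<Rightarrow> ('a \<Rightarrow> 'a \<Rightarrow> bool) \<Rightarrow> bool" where
  "strict_total_order_on A R \<longleftrightarrow> irreflp_on A R \<and> transp_on A R \<and> totalp_on A R"

definition reverse_orders_on :: "'a set \<Rightarrow> ('a \<Rightarrow> 'a \<Rightarrow> bool) \<Rightarrow> ('a \<Rightarrow> 'a \<Rightarrow> bool) \<Rightarrow> bool" where
  "reverse_orders_on A R S \<longleftrightarrow> (\<forall>e\<in>A. \<forall>f\<in>A. R e f \<longleftrightarrow> S f e)"

definition factors :: "'a list \<Rightarrow> 'a list set" where
  "factors w = {u. sublist u w}"

definition bispecial :: "'a list set \<Rightarrow> 'a list \<Rightarrow> bool" where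
  "bispecial L v \<longleftrightarrow>
     (\<exists>x x'. x \<noteq> x' \<and> x # v \<in> L \<and> x' # v \<in> L) \<and>
     (\<exists>y y'. y \<noteq> y' \<and> v @ [y] \<in> L \<and> v @ [y'] \<in> L)"

definition word_order_condition ::
    "'a list set \<Rightarrow> ('a \<Rightarrow> 'a \<Rightarrow> bool) \<Rightarrow> ('a \<Rightarrow> 'a \<Rightarrow> bool) \<Rightarrow> 'a list \<Rightarrow> bool" where
  "word_order_condition L ltA ltD v \<longleftrightarrow>
     (\<forall>x x' y y'. x # v @ [y] \<in> L \<and> x' # v @ [y'] \<in> L \<and> x \<noteq> x' \<and> y \<noteq> y' \<longrightarrow>
        (ltA x x' \<longleftrightarrow> ltD y y'))"

definition order_condition ::
    "'a list set \<Rightarrow> ('a \<Rightarrow> 'a \<Rightarrow> bool) \<Rightarrow> ('a \<Rightarrow> 'a \<Rightarrow> bool) \<Rightarrow> bool" where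
  "order_condition L ltA ltD \<longleftrightarrow> (\<forall>v. bispecial L v \<longrightarrow> word_order_condition L ltA ltD v)"

definition half_open_interval :: "real set \<Rightarrow> bool" where
  "half_open_interval S \<longleftrightarrow> (\<exists>a b. a < b \<and> S = {a..<b})"

definition strictly_left_of :: "real set \<Rightarrow> real set \<Rightarrow> bool" where
  "strictly_left_of S S' \<longleftrightarrow> (\<forall>x\<in>S. \<forall>y\<in>S'. x < y)"

text \<open>The map \<open>T\<close> acts on the interval \<open>I\<close>; its values outside \<open>I\<close> are irrelevant.
  The interval \<open>I\<^sub>e\<close> is \<open>J e\<close>.\<close>

definition standard_iet ::
    "'a set \<Rightarrow> real set \<Rightarrow> ('a \<Rightarrow> real set) \<Rightarrow> (real \<Rightarrow> real) \<Rightarrow> bool" where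
  "standard_iet A I J T \<longleftrightarrow>
     half_open_interval I \<and>
     (\<forall>e\<in>A. half_open_interval (J e)) \<and>
     disjoint_family_on J A \<and> (\<Union>e\<in>A. J e) = I \<and>
     (\<forall>e\<in>A. \<exists>t. \<forall>x\<in>J e. T x = x + t) \<and>
     disjoint_family_on (\<lambda>e. T ` J e) A \<and> (\<Union>e\<in>A. T ` J e) = I"

definition iet_order_D :: "('a \<Rightarrow> real set) \<Rightarrow> 'a \<Rightarrow> 'a \<Rightarrow> bool" where
  "iet_order_D J e f \<longleftrightarrow> strictly_left_of (J e) (J f)"

definition iet_order_A :: "('a \<Rightarrow> real set) \<Rightarrow> (real \<Rightarrow> real) \<Rightarrow> 'a \<Rightarrow> 'a \<Rightarrow> bool" where
  "iet_order_A J T e f \<longleftrightarrow> strictly_left_of (T ` J e) (T ` J f)"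

definition symmetric_iet :: "'a set \<Rightarrow> ('a \<Rightarrow> real set) \<Rightarrow> (real \<Rightarrow> real) \<Rightarrow> bool" where
  "symmetric_iet A J T \<longleftrightarrow> reverse_orders_on A (iet_order_D J) (iet_order_A J T)"

definition iet_has_orders ::
    "'a set \<Rightarrow> ('a \<Rightarrow> real set) \<Rightarrow> (real \<Rightarrow> real) \<Rightarrow>
     ('a \<Rightarrow> 'a \<Rightarrow> bool) \<Rightarrow> ('a \<Rightarrow> 'a \<Rightarrow> bool) \<Rightarrow> bool" where
  "iet_has_orders A J T ltA ltD \<longleftrightarrow>
     (\<forall>e\<in>A. \<forall>f\<in>A. (ltA e f \<longleftrightarrow> iet_order_A J T e f) \<and> (ltD e f \<longleftrightarrow> iet_order_D J e f))"

text \<open>\<open>T\<^sup>n x\<close> for \<open>n \<in> \<int>\<close>; an interval exchange is a bijection of \<open>I\<close>, so that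
  \<open>inv_into I T\<close> is its inverse there.\<close>

definition int_iterate :: "real set \<Rightarrow> (real \<Rightarrow> real) \<Rightarrow> int \<Rightarrow> real \<Rightarrow> real" where
  "int_iterate I T n x =
     (if n \<ge> 0 then (T ^^ nat n) x else (inv_into I T ^^ nat (- n)) x)"

definition is_trajectory ::
    "'a set \<Rightarrow> real set \<Rightarrow> ('a \<Rightarrow> real set) \<Rightarrow> (real \<Rightarrow> real) \<Rightarrow> real \<Rightarrow> (int \<Rightarrow> 'a) \<Rightarrow> bool" where
  "is_trajectory A I J T x s \<longleftrightarrow>
     (\<forall>n. s n \<in> A \<and> (\<forall>e\<in>A. s n = e \<longleftrightarrow> int_iterate I T n x \<in> J e))"

definition natural_coding ::
    "'a set \<Rightarrow> real set \<Rightarrow> ('a \<Rightarrow> real set) \<Rightarrow> (real \<Rightarrow> real) \<Rightarrow> 'a list set" where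
  "natural_coding A I J T =
     {u. \<exists>x\<in>I. \<exists>s. is_trajectory A I J T x s \<and>
        (\<exists>k. \<forall>i<length u. u ! i = s (k + int i))}"

end

theory Submission
  imports Defs
begin

text \<open>Centre the interval at \<open>0\<close>. A symmetric exchange then moves each \<open>I\<^sub>e\<close>, with centre \<open>c\<^sub>e\<close>, by \<open>- 2 c\<^sub>e\<close> onto its
  mirror image. That codings satisfy the order condition is clear, since \<open>T\<close> to the power \<open>|v|\<close> is a translation
  on the points whose coding starts with \<open>v\<close>.

  Conversely, argue by induction on \<open>|w|\<close>. Let \<open>a\<close> and \<open>z\<close> be the extreme letters of \<open>w\<close>. The order condition for
  the empty word, together with the fact that \<open>w\<close> is one connected word, forces \<open>z\<close> to occur only
  between two \<open>a\<close>'s, or the other way round; the two cases are mirror images. The order condition also implies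
  that the maximal blocks \<open>(az)\<^sup>j a\<close> have \<open>j \<in> {k, k + 1}\<close> for some \<open>k\<close>. After completing the blocks at both ends of \<open>w\<close>, read
  \<open>(az)\<^sup>k a\<close> as a new letter \<open>a\<close> and \<open>(az)\<^sup>k\<^sup>+\<^sup>1 a\<close> as a new letter \<open>z\<close>, ranked just above \<open>a\<close>. The shorter word
  satisfies the order condition for the new (again symmetric) orders: this is the induction of a symmetric exchange
  on the interval obtained by cutting off both ends symmetrically, and it can be undone on the
  level of lengths. Letters that do not occur finally get a small positive length.\<close>

section \<open>The order condition for words and extension by a letter\<close>

text \<open>The letters are ranked by \<open>r\<close>, increasingly for the order \<open>A\<close> and hence decreasingly for the order \<open>D\<close>.\<close>

definition sym_order_cond :: "('a \<Rightarrow> real) \<Rightarrow> 'a list \<Rightarrow> bool" where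
  "sym_order_cond r w \<longleftrightarrow>
     (\<forall>x v y x' y'. sublist (x # v @ [y]) w \<and> sublist (x' # v @ [y']) w \<and> x \<noteq> x' \<and> y \<noteq> y' \<longrightarrow>
        (r x < r x' \<longleftrightarrow> r y' < r y))"

lemma sym_order_condD:
  assumes "sym_order_cond r w" "sublist (x # v @ [y]) w" "sublist (x' # v @ [y']) w"
    "x \<noteq> x'" "y \<noteq> y'"
  shows "r x < r x' \<longleftrightarrow> r y' < r y"
  using assms unfolding sym_order_cond_def by blast

lemma sublist_in_set:
  assumes "sublist (x # v @ [y]) w"
  shows "x \<in> set w" "y \<in> set w"
  using set_mono_sublist[OF assms] by auto

text \<open>Reversal swaps left and right extensions, and since the two orders are reverses of each
  other the condition keeps its form. Results on right ends thus transfer to left ends.\<close>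

lemma sym_order_cond_rev:
  assumes "sym_order_cond r w" "inj_on r (set w)"
  shows "sym_order_cond r (rev w)"
  unfolding sym_order_cond_def
proof (intro allI impI, elim conjE)
  fix x v y x' y'
  assume *: "sublist (x # v @ [y]) (rev w)" "sublist (x' # v @ [y']) (rev w)" "x \<noteq> x'" "y \<noteq> y'"
  have s: "sublist (y # rev v @ [x]) w" "sublist (y' # rev v @ [x']) w"
    using *(1,2) by (simp_all add: sublist_rev_right)
  have "r x \<noteq> r x'" "r y \<noteq> r y'"
    using sublist_in_set[OF s(1)] sublist_in_set[OF s(2)] * assms(2) by (auto dest: inj_onD)
  then show "r x < r x' \<longleftrightarrow> r y' < r y"
    using sym_order_condD[OF assms(1) s *(4,3)] by auto
qed

text \<open>The mirror image in which the extreme letters trade places: swapping the two occurrences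
  compensates the change of sign.\<close>

lemma sym_order_cond_uminus:
  assumes "sym_order_cond r w" "inj_on r (set w)"
  shows "sym_order_cond (\<lambda>e. - r e) w"
  unfolding sym_order_cond_def
proof (intro allI impI, elim conjE)
  fix x v y x' y'
  assume *: "sublist (x # v @ [y]) w" "sublist (x' # v @ [y']) w" "x \<noteq> x'" "y \<noteq> y'"
  show "- r x < - r x' \<longleftrightarrow> - r y' < - r y"
    using sym_order_condD[OF assms(1) *(2,1)] * by auto
qed

lemma sublist_snoc_iff: "sublist u (w @ [e]) \<longleftrightarrow> sublist u w \<or> suffix u (w @ [e])"
  by (metis sublist_Cons_right sublist_rev suffix_to_prefix rev.simps(2) rev_rev_ident)

lemma suffix_shorter:
  assumes "suffix (x # v) w" "suffix (y # u) w" "length v < length u"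
  shows "suffix (x # v) u"
proof -
  have "suffix (x # v) (y # u)"
    using assms suffix_length_suffix[of "x # v" w "y # u"] by simp
  then show ?thesis using assms(3) by (auto simp: suffix_Cons)
qed

lemma suffix_same_length:
  assumes "suffix u w" "suffix v w" "length u = length v"
  shows "u = v"
  using assms by (auto simp: suffix_def)

text \<open>Only factors ending in the new letter are new, and two of these never differ in their
  last letter. So a suffix \<open>x # v\<close> of \<open>w\<close> need only be compared with older
  occurrences of \<open>v\<close>.\<close>

lemma sym_order_cond_snocI:
  assumes oc: "sym_order_cond r w" and inj: "inj_on r (insert e (set w))"
    and new: "\<And>x v x' y'. suffix (x # v) w \<Longrightarrow> sublist (x' # v @ [y']) w \<Longrightarrow> x \<noteq> x' \<Longrightarrow> y' \<noteq> e
      \<Longrightarrow> r x < r x' \<longleftrightarrow> r y' < r e"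
  shows "sym_order_cond r (w @ [e])"
  unfolding sym_order_cond_def
proof (intro allI impI, elim conjE)
  fix x v y x' y'
  assume s: "sublist (x # v @ [y]) (w @ [e])" "sublist (x' # v @ [y']) (w @ [e])"
    and ne: "x \<noteq> x'" "y \<noteq> y'"
  have suf: "suffix (b # v) w \<and> c = e" if "suffix (b # v @ [c]) (w @ [e])" for b c
    using that snoc_suffix_snoc[of "b # v" c w e] by simp
  have "{x, x', y, y'} \<subseteq> insert e (set w)"
    using sublist_in_set[OF s(1)] sublist_in_set[OF s(2)] by simp
  then have r: "r x \<noteq> r x'" "r y \<noteq> r y'"
    using ne inj by (simp_all add: inj_on_eq_iff[OF inj])
  consider "sublist (x # v @ [y]) w" "sublist (x' # v @ [y']) w"
    | "suffix (x # v @ [y]) (w @ [e])" "sublist (x' # v @ [y']) w"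
    | "sublist (x # v @ [y]) w" "suffix (x' # v @ [y']) (w @ [e])"
    | "suffix (x # v @ [y]) (w @ [e])" "suffix (x' # v @ [y']) (w @ [e])"
    using s by (auto simp: sublist_snoc_iff)
  then show "r x < r x' \<longleftrightarrow> r y' < r y"
  proof cases
    case 1 then show ?thesis using sym_order_condD[OF oc] ne by blast
  next
    case 2 then show ?thesis using suf new ne by metis
  next
    case 3
    then have "r x' < r x \<longleftrightarrow> r y < r y'" using suf new ne by metis
    then show ?thesis using r by auto
  next
    case 4 then show ?thesis using suf ne by metis
  qed
qed

text \<open>Among the letters forced from one side, the extreme one is compatible with the constraints
  from the other side: of two competing suffixes of \<open>w\<close> the shorter one occurs inside the
  longer one, so the conflict would already be visible in \<open>w\<close>.\<close>

lemma sym_order_cond_extend: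
  assumes oc: "sym_order_cond r w" and inj: "inj_on r (insert a (set w))"
    and min: "\<And>e. e \<in> set w \<Longrightarrow> r a \<le> r e"
  shows "sym_order_cond r (w @ [a]) \<or>
    (\<exists>x v x' e. suffix (x # v) w \<and> sublist (x' # v @ [e]) w \<and> r x < r x' \<and> sym_order_cond r (w @ [e]))"
proof -
  \<comment> \<open>The lower bounds on the new letter: by \<open>r x < r x'\<close> it must rank at
    least as high as each \<open>y\<close> in \<open>Y\<close>.\<close>
  define Y where "Y = {y. \<exists>x v x'. suffix (x # v) w \<and> sublist (x' # v @ [y]) w \<and> r x < r x'}"
  have Yw: "Y \<subseteq> set w"
    unfolding Y_def using sublist_in_set by fastforce
  show ?thesis
  proof (cases "Y = {}")
    case True
    \<comment> \<open>Without lower bounds the minimal letter works: both sides of the equivalence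
      are false.\<close>
    have "sym_order_cond r (w @ [a])"
    proof (rule sym_order_cond_snocI[OF oc inj])
      fix x v x' y'
      assume *: "suffix (x # v) w" "sublist (x' # v @ [y']) w"
      have "\<not> r x < r x'" using True * unfolding Y_def by blast
      moreover have "\<not> r y' < r a" using min[OF sublist_in_set(2)[OF *(2)]] by simp
      ultimately show "r x < r x' \<longleftrightarrow> r y' < r a" by simp
    qed
    then show ?thesis ..
  next
    case False
    have "finite Y" using Yw finite_subset by blast
    then obtain e where eY: "e \<in> Y" and e: "r e = Max (r ` Y)"
      using False Max_in[of "r ` Y"] by fastforce
    have emax: "r y \<le> r e" if "y \<in> Y" for y
      using e \<open>finite Y\<close> that by simp
    obtain x1 v1 x1' where 1: "suffix (x1 # v1) w" "sublist (x1' # v1 @ [e]) w" "r x1 < r x1'"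
      using eY unfolding Y_def by blast
    have ew: "e \<in> set w" using eY Yw by blast
    have inj': "inj_on r (insert e (set w))" using inj ew by (simp add: inj_on_def)
    have "sym_order_cond r (w @ [e])"
    proof (rule sym_order_cond_snocI[OF oc inj'])
      fix x v x' y'
      assume 2: "suffix (x # v) w" "sublist (x' # v @ [y']) w" "x \<noteq> x'" "y' \<noteq> e"
      have y'w: "y' \<in> set w" "x' \<in> set w" using sublist_in_set[OF 2(2)] by auto
      have "x \<in> set w" using 2(1) by (meson list.set_intros(1) set_mono_suffix subsetD)
      then have rx: "r x \<noteq> r x'" using 2(3) y'w by (simp add: inj_on_eq_iff[OF inj'])
      have ry: "r y' \<noteq> r e" using 2(4) y'w ew by (simp add: inj_on_eq_iff[OF inj'])
      have False if lt: "r x' < r x" "r y' < r e"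
      proof -
        consider "length v = length v1" | "length v1 < length v" | "length v < length v1" by linarith
        then show False
        proof cases
          case 1
          then have "x # v = x1 # v1" using \<open>suffix (x1 # v1) w\<close> 2(1)
            by (intro suffix_same_length[where w = w]) simp_all
          then show False using sym_order_condD[OF oc 2(2), of x1' e] \<open>sublist (x1' # v1 @ [e]) w\<close>
              \<open>r x1 < r x1'\<close> lt 2(4) by fastforce
        next
          case 2
          then have "suffix (x1 # v1) v"
            using suffix_shorter[OF 1(1) \<open>suffix (x # v) w\<close>] by blast
          then obtain t where "v = t @ x1 # v1" by (auto simp: suffix_def)
          then have "sublist (x1 # v1 @ [y']) w"
            using \<open>sublist (x' # v @ [y']) w\<close>
            sublist_order.order_trans[of "x1 # v1 @ [y']" "x' # v @ [y']" w]
            sublist_append_leftI[of "x1 # v1 @ [y']" "x' # t"] by simp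
          then show False using sym_order_condD[OF oc _ 1(2), of x1 y'] 1(3) lt \<open>y' \<noteq> e\<close> by fastforce
        next
          case 3
          then have "suffix (x # v) v1"
            using suffix_shorter[OF 2(1) 1(1)] by blast
          then obtain t where "v1 = t @ x # v" by (auto simp: suffix_def)
          then have "sublist (x # v @ [e]) w"
            using 1(2)
            sublist_order.order_trans[of "x # v @ [e]" "x1' # v1 @ [e]" w]
            sublist_append_leftI[of "x # v @ [e]" "x1' # t"] by simp
          then show False using sym_order_condD[OF oc 2(2), of x e] lt 2(3,4) by fastforce
        qed
      qed
      moreover have "r y' \<le> r e" if "r x < r x'"
        using emax 2(1,2) that unfolding Y_def by blast
      ultimately show "r x < r x' \<longleftrightarrow> r y' < r e" using rx ry by force
    qed
    \<comment> \<open>The witnesses stay in the conclusion: they later restrict or exclude the case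
      \<open>e = z\<close>.\<close>
    then show ?thesis using 1 by blast
  qed
qed

section \<open>Isolated letters and alternating blocks\<close>

text \<open>Neighbours are prescribed only where they exist, so a word may still begin or end with
  \<open>z\<close>.\<close>

definition isolated_by :: "'a \<Rightarrow> 'a \<Rightarrow> 'a list \<Rightarrow> bool" where
  "isolated_by a z w \<longleftrightarrow> (\<forall>x. sublist [x, z] w \<longrightarrow> x = a) \<and> (\<forall>y. sublist [z, y] w \<longrightarrow> y = a)"

lemma isolated_by_sublist: "isolated_by a z w \<Longrightarrow> sublist u w \<Longrightarrow> isolated_by a z u"
  unfolding isolated_by_def by (meson sublist_order.order_trans)

lemma isolated_by_rev: "isolated_by a z (rev w) \<longleftrightarrow> isolated_by a z w"
  unfolding isolated_by_def by (auto simp: sublist_rev_right)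

lemma isolated_by_snoc:
  assumes "isolated_by a z w" "e = z \<Longrightarrow> w \<noteq> [] \<Longrightarrow> last w = a" "w \<noteq> [] \<Longrightarrow> last w = z \<Longrightarrow> e = a"
  shows "isolated_by a z (w @ [e])"
proof -
  have *: "suffix [x, y] (w @ [e]) \<longleftrightarrow> w \<noteq> [] \<and> x = last w \<and> y = e" for x y
    by (cases w rule: rev_cases) (auto simp: suffix_def)
  show ?thesis using assms unfolding isolated_by_def by (simp only: sublist_snoc_iff *) blast
qed

text \<open>The block \<open>(az)^n a\<close>, a palindrome.\<close>

fun alt_word :: "'a \<Rightarrow> 'a \<Rightarrow> nat \<Rightarrow> 'a list" where
  "alt_word a z 0 = [a]"
| "alt_word a z (Suc n) = a # z # alt_word a z n"

lemma alt_word_Suc': "alt_word a z (Suc n) = alt_word a z n @ [z, a]"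
  by (induction n) auto

lemma alt_word_add: "alt_word a z (m + Suc n) = alt_word a z m @ z # alt_word a z n"
  by (induction m) auto

lemma rev_alt_word [simp]: "rev (alt_word a z n) = alt_word a z n"
  by (induction n) (simp, metis alt_word.simps(2) alt_word_Suc' append_Cons append_Nil rev.simps(2) rev_append
      append_assoc)

lemma length_alt_word [simp]: "length (alt_word a z n) = 2 * n + 1"
  by (induction n) auto

lemma count_alt_word: "a \<noteq> z \<Longrightarrow> count_list (alt_word a z n) z = n"
  by (induction n) auto

lemma alt_word_neq_Nil [simp]: "alt_word a z n \<noteq> []" "[] \<noteq> alt_word a z n"
  by (cases n; simp)+

lemma hd_alt_word [simp]: "hd (alt_word a z n) = a"
  by (cases n) auto

lemma last_alt_word [simp]: "last (alt_word a z n) = a"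
  by (induction n) auto

lemma set_alt_word: "set (alt_word a z n) \<subseteq> {a, z}"
  by (induction n) auto

section \<open>Completing blocks of the extreme letters\<close>

lemma alt_word_adjacent:
  assumes "alt_word a z n @ [z] = t @ x # y # u"
  shows "x = a \<and> y = z \<or> x = z \<and> y = a"
  using assms
proof (induction n arbitrary: t)
  case 0
  then show ?case by (cases t) (auto simp: Cons_eq_append_conv)
next
  case (Suc n)
  show ?case
  proof (cases t)
    case Nil then show ?thesis using Suc.prems by auto
  next
    case (Cons b t')
    note tC = Cons
    show ?thesis
    proof (cases t')
      case Nil
      have "x = z" using Suc.prems tC Nil by auto
      moreover have "alt_word a z n @ [z] = y # u" using Suc.prems tC Nil by auto
      then have "y = hd (alt_word a z n @ [z])" by simp
      ultimately have "x = z" "y = a" by simp_all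
      then show ?thesis by simp
    next
      case (Cons b' t'')
      then show ?thesis using Suc.prems tC Suc.IH[of t''] by auto
    qed
  qed
qed

lemma alt_word_append_pairs:
  "alt_word a z n @ concat (replicate i [z, a]) = alt_word a z (n + i)"
proof (induction i)
  case (Suc i)
  have "concat (replicate (Suc i) [z, a]) = concat (replicate i [z, a]) @ [z, a]"
    by (induction i) auto
  then show ?case using Suc alt_word_Suc'[of a z "n + i"] by (metis add_Suc_right append.assoc)
qed simp

text \<open>Pairs \<open>za\<close> are peeled off from the right: isolation puts an
  \<open>a\<close> before each such \<open>z\<close>, and \<open>hd w \<noteq> z\<close> ensures
  that a letter is there.\<close>

lemma alt_word_suffix_decomp:
  assumes "isolated_by a z w" "w \<noteq> []" "hd w \<noteq> z" "last w = a"
  shows "\<exists>B n. w = B @ alt_word a z n \<and> (B = [] \<or> last B \<noteq> z)"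
  using assms
proof (induction "length w" arbitrary: w rule: less_induct)
  case less
  obtain u where u: "w = u @ [a]" using less.prems by (metis append_butlast_last_id)
  show ?case
  proof (cases "u = [] \<or> last u \<noteq> z")
    case True
    then show ?thesis using u by (intro exI[of _ u] exI[of _ 0]) simp
  next
    case False
    then obtain u' where u': "u = u' @ [z]" by (metis append_butlast_last_id)
    have ne: "u' \<noteq> []" using u u' less.prems(3) by auto
    then obtain u'' b where u'': "u' = u'' @ [b]" by (metis append_butlast_last_id)
    have "sublist [b, z] w" unfolding u u' u'' using sublist_appendI[of "[b, z]" u'' "[a]"] by simp
    then have "b = a" using less.prems(1) unfolding isolated_by_def by blast
    have "isolated_by a z u'" using less.prems(1) isolated_by_sublist[of a z w u'] u u' by simp
    then obtain B n where "u' = B @ alt_word a z n" "B = [] \<or> last B \<noteq> z"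
      using less.hyps[of u'] u u' u'' \<open>b = a\<close> less.prems(3) ne by (cases u'') auto
    then show ?thesis using u u' alt_word_Suc'[of a z n]
      by (intro exI[of _ B] exI[of _ "Suc n"]) simp
  qed
qed

text \<open>The mirrored situation is this locale again, with \<open>- r\<close> for
  \<open>r\<close> and with \<open>a\<close> and \<open>z\<close> swapped.\<close>

locale extreme_letters =
  fixes r :: "'a \<Rightarrow> real" and S :: "'a set" and a z :: 'a
  assumes inj: "inj_on r S" and aS: "a \<in> S" and zS: "z \<in> S"
    and min: "e \<in> S \<Longrightarrow> r a \<le> r e" and max: "e \<in> S \<Longrightarrow> r e \<le> r z" and az: "a \<noteq> z"
begin

lemma less_z: "e \<in> S \<Longrightarrow> e \<noteq> z \<Longrightarrow> r e < r z"
  using max[of e] inj zS by (metis inj_onD order_le_less)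

lemma a_less: "e \<in> S \<Longrightarrow> e \<noteq> a \<Longrightarrow> r a < r e"
  using min[of e] inj aS by (metis inj_onD order_le_less)

lemma inj_insert: "set w \<subseteq> S \<Longrightarrow> e \<in> S \<Longrightarrow> inj_on r (insert e (set w))"
  using inj by (meson inj_on_subset insert_subset)

text \<open>A nonempty context \<open>v\<close> ends in \<open>z\<close>, so by isolation all its
  occurrences continue with \<open>a\<close>. For empty \<open>v\<close> the left letter is the
  maximal \<open>z\<close> and the new one the minimal \<open>a\<close>, so both sides are
  false.\<close>

lemma append_a:
  assumes oc: "sym_order_cond r w" and iso: "isolated_by a z w" and S: "set w \<subseteq> S"
    and w: "w \<noteq> []" "last w = z"
  shows "sym_order_cond r (w @ [a]) \<and> isolated_by a z (w @ [a])"
proof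
  show "isolated_by a z (w @ [a])" using iso w az by (intro isolated_by_snoc) auto
  show "sym_order_cond r (w @ [a])"
  proof (rule sym_order_cond_snocI[OF oc inj_insert[OF S aS]])
    fix x v x' y'
    assume *: "suffix (x # v) w" "sublist (x' # v @ [y']) w" "x \<noteq> x'" "y' \<noteq> a"
    have l: "last (x # v) = z" using *(1) w by (auto simp: suffix_def)
    have "x' \<in> S" "y' \<in> S" using sublist_in_set[OF *(2)] S by auto
    show "r x < r x' \<longleftrightarrow> r y' < r a"
    proof (cases "v = []")
      case True
      then show ?thesis using l max[OF \<open>x' \<in> S\<close>] min[OF \<open>y' \<in> S\<close>] by simp
    next
      case False
      then obtain t where "v = t @ [z]" using l by (metis append_butlast_last_id last_ConsR)
      then have "sublist [z, y'] w"
        using *(2) sublist_order.order_trans[of "[z, y']" "x' # v @ [y']" w]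
          sublist_append_leftI[of "[z, y']" "x' # t"] by simp
      then show ?thesis using iso *(4) unfolding isolated_by_def by blast
    qed
  qed
qed

text \<open>A letter other than \<open>z\<close> closes the block. If the extension lemma yields
  \<open>z\<close>, the block followed by \<open>z\<close> already occurs in \<open>B\<close>; this
  bounds \<open>n\<close> by \<open>length B\<close>, and the argument restarts after appending
  \<open>za\<close>.\<close>

lemma extend_alt_word:
  assumes "sym_order_cond r (B @ alt_word a z n)" "isolated_by a z (B @ alt_word a z n)"
    "set B \<subseteq> S" "B = [] \<or> last B \<noteq> z"
  shows "\<exists>i e. e \<in> S \<and> e \<noteq> z \<and> sym_order_cond r (B @ alt_word a z (n + i) @ [e]) \<and>
    isolated_by a z (B @ alt_word a z (n + i) @ [e])"
  using assms
proof (induction "length B - n" arbitrary: n rule: less_induct)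
  case less
  define W where "W = B @ alt_word a z n"
  note oc = less.prems(1)[folded W_def] and iso = less.prems(2)[folded W_def]
  have WS: "set W \<subseteq> S" using less.prems(3) set_alt_word[of a z n] aS zS unfolding W_def by auto
  have W: "W \<noteq> []" "last W = a" unfolding W_def by auto
  have finish: ?case if "e \<in> S" "e \<noteq> z" "sym_order_cond r (W @ [e])" for e
    using that isolated_by_snoc[OF iso, of e] W az unfolding W_def
    by (intro exI[of _ 0] exI[of _ e]) simp
  consider "sym_order_cond r (W @ [a])" | x v x' e where "suffix (x # v) W"
    "sublist (x' # v @ [e]) W" "r x < r x'" "sym_order_cond r (W @ [e])"
    using sym_order_cond_extend[OF oc inj_insert[OF WS aS]] WS min by blast
  then show ?case
  proof cases
    case 1 then show ?thesis using finish aS az by blast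
  next
    case 2
    have xS: "x \<in> S" "x' \<in> S" "e \<in> S"
      using sublist_in_set[OF 2(2)] set_mono_suffix[OF 2(1)] WS by auto
    show ?thesis
    proof (cases "e = z")
      case False then show ?thesis using finish 2(4) xS by blast
    next
      case True
      have xz: "x \<noteq> z" using 2(3) max xS by force
      have x'z: "x' = a" if "v = z # t \<or> v = []" for t
      proof -
        have "sublist [x', z] (x' # v @ [e])" using that True by auto
        then show ?thesis using 2(2) iso sublist_order.order_trans unfolding isolated_by_def by blast
      qed
      \<comment> \<open>A shorter context would leave \<open>x # v\<close> inside the block. Then
        \<open>x = a\<close> and \<open>v @ [e]\<close> starts with \<open>z\<close>, so isolation
        gives \<open>x' = a\<close> too.\<close>
      have "2 * n + 1 \<le> length v"
      proof (rule ccontr)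
        assume "\<not> 2 * n + 1 \<le> length v"
        then have "suffix (x # v) (alt_word a z n)"
          using 2(1) suffix_length_suffix[of "x # v" W "alt_word a z n"] suffixI[OF W_def] by simp
        then obtain t where t: "alt_word a z n = t @ x # v" by (auto simp: suffix_def)
        have "x \<in> {a, z}" using set_alt_word[of a z n] t by auto
        then have "x = a" using xz by simp
        have "v = [] \<or> v = z # tl v"
          using alt_word_adjacent[of a z n t x "hd v" "tl v @ [z]"] t \<open>x = a\<close> az by (cases v) auto
        then have "x' = a" using x'z by blast
        then show False using \<open>x = a\<close> 2(3) by simp
      qed
      moreover have "suffix v W" using 2(1) by (meson suffix_ConsD)
      ultimately have "suffix (alt_word a z n) v"
        using suffix_length_suffix[of "alt_word a z n" W v] suffixI[OF W_def] by simp
      then obtain t where "v = t @ alt_word a z n" by (auto simp: suffix_def)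
      then have f: "sublist (alt_word a z n @ [z]) W"
        using 2(2) True sublist_order.order_trans[of "alt_word a z n @ [z]" "x' # v @ [e]" W]
          sublist_append_leftI[of "alt_word a z n @ [z]" "x' # t"] by simp
      \<comment> \<open>An occurrence straddling the border would have \<open>last B\<close> next to
        the first \<open>a\<close> of the block, and alternation would make \<open>last B\<close>
        equal to \<open>z\<close>.\<close>
      have "sublist (alt_word a z n @ [z]) B"
      proof -
        consider "sublist (alt_word a z n @ [z]) B" | "sublist (alt_word a z n @ [z]) (alt_word a z n)"
          | f1 f2 where "alt_word a z n @ [z] = f1 @ f2" "suffix f1 B" "prefix f2 (alt_word a z n)"
          using f unfolding W_def sublist_append by blast
        then show ?thesis
        proof cases
          case 2 then show ?thesis using sublist_length_le[OF 2] by simp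
        next
          case 3
          show ?thesis
          proof (cases "f1 = [] \<or> f2 = []")
            case True
            moreover have "f1 \<noteq> []"
              using 3(1) prefix_length_le[OF 3(3)] by (metis Suc_n_not_le_n append_Nil length_append_singleton)
            ultimately show ?thesis using 3 by auto
          next
            case False
            then obtain t1 x1 t2 y2 where f12: "f1 = t1 @ [x1]" "f2 = y2 # t2"
              by (metis append_butlast_last_id list.exhaust)
            have "y2 = a" using 3(3) f12 by (metis alt_word_neq_Nil(1) hd_alt_word list.sel(1) prefix_Cons
                  list.collapse list.discI list.inject)
            moreover have "x1 = last B" "B \<noteq> []" using 3(2) f12 by (auto simp: suffix_def)
            ultimately show ?thesis
              using alt_word_adjacent[of a z n t1 x1 y2 t2] 3(1) f12 less.prems(4) az by auto
          qed
        qed blast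
      qed
      from sublist_length_le[OF this] have "2 * n + 2 \<le> length B" by simp
      moreover have "sym_order_cond r (B @ alt_word a z (Suc n)) \<and>
          isolated_by a z (B @ alt_word a z (Suc n))"
      proof -
        have "isolated_by a z (W @ [z])" by (rule isolated_by_snoc[OF iso]) (use W az in auto)
        then have "sym_order_cond r ((W @ [z]) @ [a]) \<and> isolated_by a z ((W @ [z]) @ [a])"
          using 2(4) True WS zS by (intro append_a) simp_all
        moreover have "(W @ [z]) @ [a] = B @ alt_word a z (Suc n)"
          unfolding W_def alt_word_Suc' by simp
        ultimately show ?thesis by (simp only:)
      qed
      ultimately have "\<exists>i e. e \<in> S \<and> e \<noteq> z \<and> sym_order_cond r (B @ alt_word a z (Suc n + i) @ [e]) \<and>
          isolated_by a z (B @ alt_word a z (Suc n + i) @ [e])"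
        by (intro less.hyps less.prems(3,4)) simp_all
      then show ?thesis by (metis add_Suc_shift)
    qed
  qed
qed

text \<open>Only a word ending in \<open>a\<close> can stop in the middle of a block; that block is
  split off and extended. Otherwise one letter suffices.\<close>

lemma complete_right:
  assumes oc: "sym_order_cond r w" and iso: "isolated_by a z w" and S: "set w \<subseteq> S"
    and w: "w \<noteq> []" "hd w \<noteq> z" "last w \<noteq> z"
  shows "\<exists>i e. e \<in> S \<and> e \<noteq> z \<and> sym_order_cond r (w @ concat (replicate i [z, a]) @ [e]) \<and>
    isolated_by a z (w @ concat (replicate i [z, a]) @ [e])"
proof (cases "last w = a")
  case True
  then obtain B n where B: "w = B @ alt_word a z n" "B = [] \<or> last B \<noteq> z"
    using alt_word_suffix_decomp iso w by metis
  have eq: "B @ alt_word a z (n + i) @ [e] = w @ concat (replicate i [z, a]) @ [e]" for i e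
    unfolding B(1) alt_word_append_pairs[symmetric] by simp
  show ?thesis
    using extend_alt_word[of B n, unfolded eq] B oc iso S by simp
next
  case False
  have finish: ?thesis if "e \<in> S" "e \<noteq> z" "sym_order_cond r (w @ [e])" for e
    using that isolated_by_snoc[OF iso, of e] w
    by (intro exI[of _ 0] exI[of _ e]) simp
  consider "sym_order_cond r (w @ [a])" | x v x' e where "suffix (x # v) w"
    "sublist (x' # v @ [e]) w" "r x < r x'" "sym_order_cond r (w @ [e])"
    using sym_order_cond_extend[OF oc inj_insert[OF S aS]] S min by blast
  then show ?thesis
  proof cases
    case 1 then show ?thesis using finish aS az by blast
  next
    case 2
    have xS: "x \<in> S" "e \<in> S"
      using sublist_in_set[OF 2(2)] set_mono_suffix[OF 2(1)] S by auto
    \<comment> \<open>If \<open>z\<close> were produced, isolation would make \<open>x' # v\<close>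
      end in \<open>a\<close>. Nonempty \<open>v\<close> would give \<open>last w = a\<close>, and
      empty \<open>v\<close> gives \<open>x' = a\<close>, which \<open>r x < r x'\<close>
      forbids.\<close>
    have "e \<noteq> z"
    proof
      assume "e = z"
      have "sublist [last (x' # v), z] (x' # v @ [e])"
        using \<open>e = z\<close> sublist_append_leftI[of "[last (x' # v), z]" "butlast (x' # v)"]
          append_butlast_last_id[of "x' # v"] by (metis append_Cons append_assoc append_Nil list.discI)
      then have l: "last (x' # v) = a"
        using 2(2) iso sublist_order.order_trans unfolding isolated_by_def by blast
      have "last (x # v) = last w" using 2(1) by (auto simp: suffix_def)
      then have "v = []" using l False by (cases "v = []") simp_all
      then show False using l 2(3) min[OF xS(1)] by simp
    qed
    then show ?thesis using finish 2(4) xS by blast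
  qed
qed

text \<open>The letters \<open>z0\<close> and \<open>z1\<close> certify that the outermost blocks of
  \<open>U\<close> are maximal. Each block \<open>(az)^j a\<close> and each other letter adds 1 to
  \<open>length U - 2 * count_list U z\<close>, so the last inequality says that \<open>U\<close>
  has fewer blocks than \<open>w\<close> has letters.\<close>

lemma complete_blocks:
  assumes oc: "sym_order_cond r w" and iso: "isolated_by a z w" and S: "set w \<subseteq> S"
    and w: "2 \<le> length w" "z \<in> set w"
  shows "\<exists>z0 U z1. z0 \<in> S - {z} \<and> z1 \<in> S - {z} \<and> sym_order_cond r (z0 # U @ [z1]) \<and>
    isolated_by a z U \<and> sublist w U \<and> set U \<subseteq> S \<and> hd U \<noteq> z \<and> last U \<noteq> z \<and>
    length U < length w + 2 * count_list U z"
proof -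
  define w1 where "w1 = (if last w = z then w @ [a] else w)"
  define w2 where "w2 = (if hd w1 = z then a # w1 else w1)"
  have w1: "sym_order_cond r w1 \<and> isolated_by a z w1"
    unfolding w1_def using append_a[OF oc iso S] oc iso w by (cases "w = []") auto
  have S1: "set w1 \<subseteq> S" "w1 \<noteq> []" "last w1 \<noteq> z" unfolding w1_def using S aS az w by auto
  have w1r: "sym_order_cond r (rev w1)" "isolated_by a z (rev w1)"
    using sym_order_cond_rev[of r w1] w1 inj_on_subset[OF inj S1(1)] by (auto simp: isolated_by_rev)
  have w2r: "sym_order_cond r (rev w2) \<and> isolated_by a z (rev w2)"
    unfolding w2_def using append_a[OF w1r] w1r S1 by (auto simp: last_rev)
  have S2: "set w2 \<subseteq> S" "w2 \<noteq> []" "last w2 \<noteq> z" "hd w2 \<noteq> z" unfolding w2_def using S1 aS az by auto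
  have w2: "sym_order_cond r w2 \<and> isolated_by a z w2"
    using sym_order_cond_rev[of r "rev w2"] w2r inj_on_subset[OF inj S2(1)] by (auto simp: isolated_by_rev)
  obtain i z1 where 1: "z1 \<in> S" "z1 \<noteq> z" "sym_order_cond r (w2 @ concat (replicate i [z, a]) @ [z1])"
    "isolated_by a z (w2 @ concat (replicate i [z, a]) @ [z1])"
    using complete_right[of w2] w2 S2 by blast
  define V where "V = w2 @ concat (replicate i [z, a])"
  have VS: "set (V @ [z1]) \<subseteq> S" "hd (V @ [z1]) \<noteq> z" "V \<noteq> []"
    unfolding V_def using S2 1 aS zS by (auto simp: set_replicate_conv_if)
  have lV: "last V \<noteq> z"
  proof (cases i)
    case 0 then show ?thesis using S2 unfolding V_def by simp
  next
    case (Suc m)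
    have "concat (replicate (Suc m) [z, a]) = concat (replicate m [z, a]) @ [z, a]"
      by (induction m) auto
    then show ?thesis unfolding V_def Suc using az by simp
  qed
  have "sym_order_cond r (rev (V @ [z1]))" "isolated_by a z (rev (V @ [z1]))"
    using sym_order_cond_rev[of r "V @ [z1]"] 1(3,4) inj_on_subset[OF inj VS(1)]
    unfolding V_def isolated_by_rev by simp_all
  then obtain j z0 where 2: "z0 \<in> S" "z0 \<noteq> z"
    "sym_order_cond r (rev (V @ [z1]) @ concat (replicate j [z, a]) @ [z0])"
    "isolated_by a z (rev (V @ [z1]) @ concat (replicate j [z, a]) @ [z0])"
    using complete_right[of "rev (V @ [z1])"] VS 1 by (auto simp: last_rev)
  define Q where "Q = concat (replicate j [a, z])"
  have Qr: "rev (concat (replicate j [z, a])) = Q"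
    unfolding Q_def by (simp add: rev_concat)
  define U where "U = Q @ V"
  have eq: "rev (rev (V @ [z1]) @ concat (replicate j [z, a]) @ [z0]) = z0 # U @ [z1]"
    unfolding U_def Qr[symmetric] by simp
  have US: "set U \<subseteq> S" using VS aS zS unfolding U_def Q_def by (auto simp: set_replicate_conv_if)
  have setU: "set (z0 # U @ [z1]) \<subseteq> S" using US 2(1) 1(1) by simp
  have ocU: "sym_order_cond r (z0 # U @ [z1])"
    using sym_order_cond_rev[OF 2(3)] unfolding eq
    by (metis eq setU inj inj_on_subset set_rev)
  have isoU: "isolated_by a z U"
    using 2(4) isolated_by_rev[of a z "rev (V @ [z1]) @ concat (replicate j [z, a]) @ [z0]"]
      isolated_by_sublist[of a z "z0 # U @ [z1]" U] sublist_appendI[of U "[z0]" "[z1]"] unfolding eq by simp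
  have "hd U \<noteq> z"
    unfolding U_def Q_def using az VS S2 by (cases j) (auto simp: V_def)
  moreover have "last U \<noteq> z" unfolding U_def using VS lV by simp
  moreover have "sublist w U"
  proof -
    have "sublist w w1" unfolding w1_def by simp
    moreover have "sublist w1 w2" unfolding w2_def using sublist_append_leftI[of w1 "[a]"] by simp
    moreover have "sublist w2 U" unfolding U_def V_def by simp
    ultimately show ?thesis by (meson sublist_order.order_trans)
  qed
  moreover have "length U < length w + 2 * count_list U z"
  proof -
    have q: "length (concat (replicate i [z, a])) = 2 * i" "count_list (concat (replicate i [z, a])) z = i" for i
      using az by (induction i) auto
    have q': "length (concat (replicate i [a, z])) = 2 * i" "count_list (concat (replicate i [a, z])) z = i" for i
      using az by (induction i) auto
    have c: "0 < count_list w z" using w(2) count_list_0_iff[of w z] by (simp del: count_list_0_iff)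
    \<comment> \<open>Two letters are added only if \<open>w\<close> starts and ends with
      \<open>z\<close>, and then it contains two of them; otherwise a single \<open>z\<close> pays
      for the one letter added. Later pairs contain one \<open>z\<close> each and keep the
      balance.\<close>
    have "length w2 < length w + 2 * count_list w2 z"
    proof (cases "hd w1 = z \<and> last w = z")
      case True
      then have "hd w = z" unfolding w1_def using w by (cases w) auto
      then obtain u where "w = z # u @ [z]"
        using True w(1) by (cases w; cases "tl w" rule: rev_cases) auto
      then show ?thesis unfolding w2_def w1_def using az by auto
    next
      case False
      then show ?thesis unfolding w2_def w1_def using c az by auto
    qed
    then show ?thesis unfolding U_def V_def Q_def by (simp add: q q')
  qed
  ultimately show ?thesis using 1(1,2) 2(1,2) ocU isoU US by blast
qed

end

section \<open>Desubstitution\<close>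

definition block :: "'a \<Rightarrow> 'a \<Rightarrow> 'a \<times> nat \<Rightarrow> 'a list" where
  "block a z b = (if fst b = a then alt_word a z (snd b) else [fst b])"

text \<open>The form of \<open>block\<close> once only the exponents \<open>k\<close> and
  \<open>k + 1\<close> remain. The letter \<open>z\<close> is free to name the longer block, as
  every old \<open>z\<close> is absorbed in a block.\<close>

definition block_subst :: "'a \<Rightarrow> 'a \<Rightarrow> nat \<Rightarrow> 'a \<Rightarrow> 'a list" where
  "block_subst a z k e =
     (if e = a then alt_word a z k else if e = z then alt_word a z (Suc k) else [e])"

text \<open>An \<open>a\<close> followed by \<open>z\<close> lengthens by one the block that starts
  two letters later; a letter not followed by \<open>z\<close> is a block by itself.\<close>

lemma block_decomp:
  assumes "isolated_by a z U" "a \<noteq> z" "U = [] \<or> hd U \<noteq> z \<and> last U \<noteq> z"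
  shows "\<exists>bs. U = concat (map (block a z) bs) \<and> fst ` set bs \<subseteq> set U - {z}"
  using assms
proof (induction "length U" arbitrary: U rule: less_induct)
  case less
  show ?case
  proof (cases U)
    case Nil then show ?thesis by (intro exI[of _ "[]"]) simp
  next
    case (Cons e V)
    have isoV: "isolated_by a z V"
      using less.prems(1) Cons isolated_by_sublist[of a z U V] sublist_append_leftI[of V "[e]"] by simp
    have ez: "e \<noteq> z" using less.prems(3) Cons by simp
    show ?thesis
    proof (cases "V = [] \<or> hd V \<noteq> z")
      case True
      then have "V = [] \<or> hd V \<noteq> z \<and> last V \<noteq> z" using less.prems(3) Cons by auto
      then obtain bs where bs: "V = concat (map (block a z) bs)" "fst ` set bs \<subseteq> set V - {z}"
        using less.hyps[of V] isoV less.prems(2) Cons by auto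
      show ?thesis
        using bs Cons ez by (intro exI[of _ "(e, 0) # bs"]) (auto simp: block_def)
    next
      case False
      then obtain V' where V': "V = z # V'" by (cases V) auto
      have "prefix [e, z] U" using Cons V' by simp
      then have "e = a" using less.prems(1) prefix_imp_sublist unfolding isolated_by_def by blast
      have ne: "V' \<noteq> []" using V' Cons less.prems(3) by auto
      then obtain f V'' where V'': "V' = f # V''" by (cases V') auto
      have "prefix [z, f] V" using V' V'' by simp
      then have "f = a" using isoV prefix_imp_sublist unfolding isolated_by_def by blast
      have "isolated_by a z V'"
        using isoV V' isolated_by_sublist[of a z V V'] sublist_append_leftI[of V' "[z]"] by simp
      moreover have "hd V' \<noteq> z \<and> last V' \<noteq> z"
        using less.prems(2,3) Cons V' ne V'' \<open>f = a\<close> by auto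
      ultimately obtain bs where bs: "V' = concat (map (block a z) bs)" "fst ` set bs \<subseteq> set V' - {z}"
        using less.hyps[of V'] less.prems(2) Cons V' by auto
      obtain b bs' where b: "bs = b # bs'" using bs ne by (cases bs) auto
      have "fst b = a"
        using bs(1) b V'' \<open>f = a\<close> by (auto simp: block_def split: if_splits)
      then have "U = concat (map (block a z) ((a, Suc (snd b)) # bs'))"
        using bs(1) b Cons V' \<open>e = a\<close> by (simp add: block_def)
      moreover have "fst ` set ((a, Suc (snd b)) # bs') \<subseteq> set U - {z}"
        using bs(2) b Cons V' \<open>e = a\<close> less.prems(2) by auto
      ultimately show ?thesis by blast
    qed
  qed
qed

text \<open>Images neither begin nor end with \<open>z\<close>, so the neighbours of a run of images
  differ from \<open>z\<close>. This is how maximality of blocks enters.\<close>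

lemma concat_map_context:
  assumes f: "\<And>x. x \<in> set (ps @ ss) \<Longrightarrow> f x \<noteq> [] \<and> hd (f x) \<noteq> z \<and> last (f x) \<noteq> z"
    and z0: "z0 \<noteq> z" and z1: "z1 \<noteq> z"
  shows "\<exists>p s. p \<noteq> z \<and> s \<noteq> z \<and>
    sublist (p # concat (map f xs) @ [s]) (z0 # concat (map f (ps @ xs @ ss)) @ [z1])"
proof -
  define P where "P = z0 # concat (map f ps)"
  define Q where "Q = concat (map f ss) @ [z1]"
  have "last P \<noteq> z"
  proof (cases ps rule: rev_cases)
    case Nil then show ?thesis using z0 by (simp add: P_def)
  next
    case (snoc ys y) then show ?thesis using f[of y] by (simp add: P_def)
  qed
  moreover have "hd Q \<noteq> z"
  proof (cases ss)
    case Nil then show ?thesis using z1 by (simp add: Q_def)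
  next
    case (Cons y ys) then show ?thesis using f[of y] by (simp add: Q_def)
  qed
  moreover have "z0 # concat (map f (ps @ xs @ ss)) @ [z1] =
      butlast P @ (last P # concat (map f xs) @ [hd Q]) @ tl Q"
  proof -
    have "P = butlast P @ [last P]" "Q = hd Q # tl Q" by (simp_all add: P_def Q_def)
    moreover have "z0 # concat (map f (ps @ xs @ ss)) @ [z1] = P @ concat (map f xs) @ Q"
      by (simp add: P_def Q_def)
    ultimately show ?thesis by (metis append.assoc append_Cons append_Nil)
  qed
  ultimately show ?thesis by (metis sublist_appendI)
qed

lemma sublist_infix_suffix_prefix:
  assumes "suffix u p" "prefix v s" "sublist (p @ m @ s) w"
  shows "sublist (u @ m @ v) w"
proof -
  obtain p' s' where "p = p' @ u" "s = v @ s'" using assms by (auto simp: suffix_def prefix_def)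
  then have "p @ m @ s = p' @ (u @ m @ v) @ s'" by simp
  then show ?thesis using assms(3) sublist_appendI sublist_order.order_trans by metis
qed

context extreme_letters
begin

text \<open>If \<open>j\<close> exceeded \<open>i + 1\<close>, the word \<open>(az)^i a\<close>
  would occur between two \<open>z\<close> inside the long block, and also between letters
  \<open>p\<close> and \<open>q\<close> other than \<open>z\<close>. As \<open>p\<close> ranks below
  \<open>z\<close>, the condition would put \<open>q\<close> above the maximal
  \<open>z\<close>.\<close>

lemma block_exponents:
  assumes oc: "sym_order_cond r (z0 # concat (map (block a z) bs) @ [z1])"
    and ctx: "z0 \<in> S - {z}" "z1 \<in> S - {z}" and bs: "fst ` set bs \<subseteq> S - {z}"
    and ij: "(a, i) \<in> set bs" "(a, j) \<in> set bs"
  shows "j \<le> Suc i"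
proof (rule ccontr)
  let ?W = "z0 # concat (map (block a z) bs) @ [z1]"
  assume "\<not> j \<le> Suc i"
  then obtain m where "j = Suc i + Suc m" by (metis less_imp_Suc_add not_le add_Suc_shift add_Suc_right)
  then have j: "alt_word a z j = [a] @ (z # alt_word a z i @ [z]) @ alt_word a z m"
    by (simp only: alt_word_add alt_word.simps append_Cons append_Nil append_assoc)
  obtain ps ss where s: "bs = ps @ [(a, i)] @ ss" using split_list[OF ij(1)] by auto
  have *: "block a z x \<noteq> [] \<and> hd (block a z x) \<noteq> z \<and> last (block a z x) \<noteq> z" if "x \<in> set bs" for x
    using that bs az by (auto simp: block_def)
  obtain p q where pq: "p \<noteq> z" "q \<noteq> z" "sublist (p # alt_word a z i @ [q]) ?W"
    using concat_map_context[of ps ss "block a z" z z0 z1 "[(a, i)]"] * s ctx by (auto simp: block_def)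
  have WS: "set ?W \<subseteq> S" using ctx bs aS zS set_alt_word[of a z] by (fastforce simp: block_def split: if_splits)
  obtain ps' ss' where "bs = ps' @ (a, j) # ss'" using split_list[OF ij(2)] by auto
  then have "?W = (z0 # concat (map (block a z) ps')) @ alt_word a z j @
      (concat (map (block a z) ss') @ [z1])"
    by (simp add: block_def)
  then have "sublist (alt_word a z j) ?W" by (metis sublist_appendI)
  moreover have "sublist (z # alt_word a z i @ [z]) (alt_word a z j)" unfolding j by (rule sublist_appendI)
  ultimately have "sublist (z # alt_word a z i @ [z]) ?W" using sublist_order.order_trans by blast
  then have "r p < r z \<longleftrightarrow> r z < r q"
    using sym_order_condD[OF oc pq(3)] pq by auto
  moreover have "p \<in> S" "q \<in> S" using sublist_in_set[OF pq(3)] WS by auto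
  ultimately show False using less_z[OF _ pq(1)] max[of q] by simp
qed

text \<open>As \<open>z\<close> takes over the rank of \<open>a\<close>, the latter moves down to
  stay minimal. In effect \<open>z\<close> moves from the top to the place next to
  \<open>a\<close>.\<close>

definition induced_rank :: "'a \<Rightarrow> real" where
  "induced_rank = r(z := r a, a := r a - 1)"

lemma induced_rank_inj: "inj_on induced_rank S"
proof (rule inj_onI)
  fix x y assume "x \<in> S" "y \<in> S" "induced_rank x = induced_rank y"
  then show "x = y"
    using a_less[of x] a_less[of y] inj_onD[OF inj, of x y] az
    by (auto simp: induced_rank_def split: if_splits)
qed

text \<open>Read from the right, the words first differ in \<open>u\<close> and \<open>u'\<close>.
  For \<open>a\<close> against \<open>z\<close> the common part is \<open>(az)^k a\<close>, preceded
  by a letter other than \<open>z\<close> and by \<open>z\<close> respectively, which is why the new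
  \<open>z\<close> ranks above \<open>a\<close>. In all other cases the last letters differ
  already.\<close>

lemma block_subst_left:
  assumes "x \<in> S" "x' \<in> S" "x \<noteq> x'" "p \<in> S" "p' \<in> S" "p \<noteq> z" "p' \<noteq> z"
  shows "\<exists>C u u'. suffix (u # C) (p # block_subst a z k x) \<and> suffix (u' # C) (p' # block_subst a z k x') \<and>
    u \<noteq> u' \<and> (r u < r u' \<longleftrightarrow> induced_rank x < induced_rank x')"
proof -
  have sz: "suffix (z # alt_word a z k) (y # block_subst a z k z)" for y
    using az by (auto simp: block_subst_def suffix_def)
  have sa: "suffix (y # alt_word a z k) (y # block_subst a z k a)" for y
    by (simp add: block_subst_def)
  have last: "suffix [if x = z then a else x] (y # block_subst a z k x)" for x y
  proof -
    have "block_subst a z k x = butlast (block_subst a z k x) @ [if x = z then a else x]"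
      using az by (auto simp: block_subst_def intro: append_butlast_last_id[symmetric])
        (metis alt_word.simps(2) alt_word_neq_Nil(1) append_butlast_last_id last_alt_word)+
    then show ?thesis by (metis append_Cons suffixI)
  qed
  consider "x = a" "x' = z" | "x = z" "x' = a" | "\<not> (x \<in> {a, z} \<and> x' \<in> {a, z})"
    using assms(3) by auto
  then show ?thesis
  proof cases
    case 1
    then show ?thesis using sa[of p] sz[of p'] less_z[OF assms(4,6)] assms(6) az
      by (intro exI[of _ "alt_word a z k"] exI[of _ p] exI[of _ z]) (simp add: induced_rank_def)
  next
    case 2
    then show ?thesis using sz[of p] sa[of p'] less_z[OF assms(5,7)] assms(7) az
      by (intro exI[of _ "alt_word a z k"] exI[of _ z] exI[of _ p']) (auto simp: induced_rank_def)
  next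
    case 3
    then show ?thesis using last[of x p] last[of x' p'] assms(3) az a_less[OF assms(1)] a_less[OF assms(2)]
      by (intro exI[of _ "[]"] exI[of _ "if x = z then a else x"] exI[of _ "if x' = z then a else x'"])
        (auto simp: induced_rank_def)
  qed
qed

lemma rev_block_subst: "rev (block_subst a z k x) = block_subst a z k x"
  by (simp add: block_subst_def del: alt_word.simps)

text \<open>The images are palindromes, so this is the left comparison read backwards.\<close>

lemma block_subst_right:
  assumes "x \<in> S" "x' \<in> S" "x \<noteq> x'" "p \<in> S" "p' \<in> S" "p \<noteq> z" "p' \<noteq> z"
  shows "\<exists>C u u'. prefix (C @ [u]) (block_subst a z k x @ [p]) \<and> prefix (C @ [u']) (block_subst a z k x' @ [p']) \<and>
    u \<noteq> u' \<and> (r u < r u' \<longleftrightarrow> induced_rank x < induced_rank x')"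
proof -
  obtain C u u' where *: "suffix (u # C) (p # block_subst a z k x)"
    "suffix (u' # C) (p' # block_subst a z k x')"
    "u \<noteq> u'" "r u < r u' \<longleftrightarrow> induced_rank x < induced_rank x'"
    using block_subst_left[OF assms] by blast
  have "prefix (rev C @ [u]) (block_subst a z k x @ [p])" "prefix (rev C @ [u']) (block_subst a z k x' @ [p'])"
    using *(1,2) by (simp_all add: suffix_to_prefix rev_block_subst)
  then show ?thesis using *(3,4) by blast
qed

text \<open>Two competing factors of \<open>w\<close> yield two factors of the long word with a
  common middle part around the image of \<open>v\<close>; their outer letters are ranked by
  \<open>r\<close> as the original ones are by \<open>induced_rank\<close>.\<close>

lemma sym_order_cond_desubst:
  assumes oc: "sym_order_cond r (z0 # concat (map (block_subst a z k) w) @ [z1])"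
    and ctx: "z0 \<in> S - {z}" "z1 \<in> S - {z}" and wS: "set w \<subseteq> S"
  shows "sym_order_cond induced_rank w"
  unfolding sym_order_cond_def
proof (intro allI impI, elim conjE)
  let ?s = "block_subst a z k"
  let ?W = "z0 # concat (map ?s w) @ [z1]"
  fix x v y x' y'
  assume s: "sublist (x # v @ [y]) w" "sublist (x' # v @ [y']) w" and ne: "x \<noteq> x'" "y \<noteq> y'"
  have WS: "set ?W \<subseteq> S"
    using ctx wS aS zS set_alt_word[of a z k] by (fastforce simp: block_subst_def split: if_splits)
  have *: "?s x \<noteq> [] \<and> hd (?s x) \<noteq> z \<and> last (?s x) \<noteq> z" for x
    using az by (auto simp: block_subst_def)
  have context_letters: "\<exists>p q. p \<in> S \<and> q \<in> S \<and> p \<noteq> z \<and> q \<noteq> z \<and> sublist ((p # ?s b) @ concat (map ?s v) @ (?s c @ [q])) ?W"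
    if bc: "sublist (b # v @ [c]) w" for b c
  proof -
    obtain ps ss where "w = ps @ (b # v @ [c]) @ ss" using bc unfolding sublist_def by blast
    then obtain p q where pq: "p \<noteq> z" "q \<noteq> z" "sublist (p # concat (map ?s (b # v @ [c])) @ [q]) ?W"
      using concat_map_context[of ps ss ?s z z0 z1 "b # v @ [c]"] * ctx by auto
    have "p \<in> S" "q \<in> S" using sublist_in_set[OF pq(3)] WS by auto
    moreover have "p # concat (map ?s (b # v @ [c])) @ [q] = (p # ?s b) @ concat (map ?s v) @ (?s c @ [q])"
      by simp
    ultimately show ?thesis using pq by metis
  qed
  obtain p q where pq: "p \<in> S" "q \<in> S" "p \<noteq> z" "q \<noteq> z"
    "sublist ((p # ?s x) @ concat (map ?s v) @ (?s y @ [q])) ?W"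
    using context_letters[OF s(1)] by blast
  obtain p' q' where pq': "p' \<in> S" "q' \<in> S" "p' \<noteq> z" "q' \<noteq> z"
    "sublist ((p' # ?s x') @ concat (map ?s v) @ (?s y' @ [q'])) ?W"
    using context_letters[OF s(2)] by blast
  have S: "x \<in> S" "y \<in> S" "x' \<in> S" "y' \<in> S"
    using sublist_in_set[OF s(1)] sublist_in_set[OF s(2)] wS by auto
  obtain C u u' where C: "suffix (u # C) (p # ?s x)" "suffix (u' # C) (p' # ?s x')" "u \<noteq> u'"
    "r u < r u' \<longleftrightarrow> induced_rank x < induced_rank x'"
    using block_subst_left[OF S(1,3) ne(1) pq(1) pq'(1) pq(3) pq'(3)] by blast
  obtain E t t' where E: "prefix (E @ [t]) (?s y @ [q])" "prefix (E @ [t']) (?s y' @ [q'])" "t \<noteq> t'"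
    "r t < r t' \<longleftrightarrow> induced_rank y < induced_rank y'"
    using block_subst_right[OF S(2,4) ne(2) pq(2) pq'(2) pq(4) pq'(4)] by blast
  let ?V = "C @ concat (map ?s v) @ E"
  have V: "sublist (u # ?V @ [t]) ?W" "sublist (u' # ?V @ [t']) ?W"
    using sublist_infix_suffix_prefix[OF C(1) E(1) pq(5)] sublist_infix_suffix_prefix[OF C(2) E(2) pq'(5)]
    by simp_all
  have "t \<in> S" "t' \<in> S" using sublist_in_set[OF V(1)] sublist_in_set[OF V(2)] WS by auto
  then have "r t \<noteq> r t'" using E(3) inj by (simp add: inj_on_eq_iff)
  moreover have "induced_rank y \<noteq> induced_rank y'"
    using S ne(2) inj_on_eq_iff[OF induced_rank_inj] by simp
  ultimately show "induced_rank x < induced_rank x' \<longleftrightarrow> induced_rank y' < induced_rank y"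
    using sym_order_condD[OF oc V C(3) E(3)] C(4) E(4) by auto
qed

lemma desubst:
  assumes oc: "sym_order_cond r w" and iso: "isolated_by a z w" and S: "set w \<subseteq> S"
    and w: "2 \<le> length w" "z \<in> set w"
  shows "\<exists>k w'. sublist w (concat (map (block_subst a z k) w')) \<and> set w' \<subseteq> S \<and>
    length w' < length w \<and> sym_order_cond induced_rank w'"
proof -
  obtain z0 U z1 where z01: "z0 \<in> S - {z}" "z1 \<in> S - {z}" and ocU: "sym_order_cond r (z0 # U @ [z1])"
    and U: "isolated_by a z U" "sublist w U" "set U \<subseteq> S" "hd U \<noteq> z" "last U \<noteq> z"
    "length U < length w + 2 * count_list U z"
    using complete_blocks[OF assms] by blast
  obtain bs where bs: "U = concat (map (block a z) bs)" "fst ` set bs \<subseteq> set U - {z}"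
    using block_decomp[OF U(1) az] U(4,5) by blast
  have bsS: "fst ` set bs \<subseteq> S - {z}" using bs(2) U(3) by auto
  define K where "K = {j. (a, j) \<in> set bs}"
  \<comment> \<open>The least exponent; by \<open>block_exponents\<close> every other one is
    \<open>k + 1\<close>.\<close>
  define k where "k = (LEAST j. j \<in> K)"
  have kK: "j = k \<or> j = Suc k" if "j \<in> K" for j
  proof -
    have "k \<in> K" "k \<le> j" unfolding k_def using that by (auto intro: LeastI Least_le)
    then show ?thesis
      using block_exponents[OF ocU[unfolded bs(1)] z01 bsS, of k j] that unfolding K_def by auto
  qed
  define g where "g = (\<lambda>b. if fst b = a then if snd b = k then a else z else fst b)"
  define w' where "w' = map g bs"
  have g: "block_subst a z k (g b) = block a z b" if "b \<in> set bs" for b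
    using kK[of "snd b"] that bsS az unfolding K_def g_def block_subst_def block_def
    by (cases b) (auto simp del: alt_word.simps)
  have Uw': "U = concat (map (block_subst a z k) w')"
    unfolding bs(1) w'_def using g by (auto intro!: arg_cong[of _ _ concat])
  have w'S: "set w' \<subseteq> S" unfolding w'_def g_def using bsS aS zS by auto
  \<comment> \<open>Counting blocks turns the length bound on \<open>U\<close> into
    \<open>length w' < length w\<close>.\<close>
  have "length u = length bs' + 2 * count_list u z"
    if "u = concat (map (block a z) bs')" "set bs' \<subseteq> set bs" for u bs'
    using that
  proof (induction bs' arbitrary: u)
    case (Cons b bs')
    then show ?case using bsS az count_alt_word[OF az, of "snd b"] by (auto simp: block_def)
  qed simp
  then have "length U = length w' + 2 * count_list U z" using bs(1) by (simp add: w'_def)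
  then have "length w' < length w" using U(6) by simp
  then show ?thesis
    using sym_order_cond_desubst[of z0 k w' z1] ocU z01 w'S U(2) unfolding Uw' by blast
qed

end

section \<open>Lengths realising a word\<close>

text \<open>The interval of the letter \<open>e\<close> has centre \<open>center r S l e\<close> and length \<open>l e\<close>; the whole interval
  is centred at \<open>0\<close>, so that the translation by \<open>- 2 * center r S l e\<close> moves it to its mirror image.\<close>

definition center :: "('a \<Rightarrow> real) \<Rightarrow> 'a set \<Rightarrow> ('a \<Rightarrow> real) \<Rightarrow> 'a \<Rightarrow> real" where
  "center r S l e = (\<Sum>f\<in>S. sgn (r f - r e) * l f) / 2"

text \<open>Here \<open>q\<close> is the current point, and on the interval of \<open>e\<close> the
  exchange is the translation by \<open>- 2 * c e\<close>. No map is mentioned, so lengths may be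
  zero.\<close>

fun orbit_coded :: "('a \<Rightarrow> real) \<Rightarrow> ('a \<Rightarrow> real) \<Rightarrow> real \<Rightarrow> 'a list \<Rightarrow> bool" where
  "orbit_coded c l q [] \<longleftrightarrow> True"
| "orbit_coded c l q (e # u) \<longleftrightarrow> \<bar>q - c e\<bar> < l e / 2 \<and> orbit_coded c l (q - 2 * c e) u"

text \<open>Lengths may vanish here, but the inequalities of \<open>orbit_coded\<close> are strict, hence stable under
  small perturbations of the lengths.\<close>

definition codable :: "'a set \<Rightarrow> ('a \<Rightarrow> real) \<Rightarrow> 'a list \<Rightarrow> bool" where
  "codable S r w \<longleftrightarrow> (\<exists>l q. (\<forall>e\<in>S. 0 \<le> l e) \<and> orbit_coded (center r S l) l q w)"

lemma orbit_coded_append: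
  "orbit_coded c l q (u @ v) \<longleftrightarrow>
     orbit_coded c l q u \<and> orbit_coded c l (q - 2 * sum_list (map c u)) v"
  by (induction u arbitrary: q) (auto simp: algebra_simps)

lemma orbit_coded_cong:
  assumes "\<And>e. e \<in> set w \<Longrightarrow> c e = c' e" "\<And>e. e \<in> set w \<Longrightarrow> l e = l' e"
  shows "orbit_coded c l q w \<longleftrightarrow> orbit_coded c' l' q w"
  using assms by (induction w arbitrary: q) auto

lemma orbit_coded_uminus: "orbit_coded (\<lambda>e. - c e) l (- q) w \<longleftrightarrow> orbit_coded c l q w"
proof (induction w arbitrary: q)
  case (Cons e w)
  have "- q - 2 * - c e = - (q - 2 * c e)" by simp
  then show ?case using Cons[of "q - 2 * c e"] by (auto simp: abs_minus_commute)
qed simp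

lemma codable_sublist: "codable S r w \<Longrightarrow> sublist u w \<Longrightarrow> codable S r u"
  unfolding codable_def sublist_def by (auto simp: orbit_coded_append) blast

lemma center_uminus: "center (\<lambda>e. - r e) S l e = - center r S l e"
  unfolding center_def sum_negf[symmetric] minus_divide_left
  by (intro arg_cong2[of _ _ _ _ "(/)"] sum.cong refl) (metis minus_diff_eq mult_minus_left sgn_minus minus_diff_minus)

lemma codable_uminus: "codable S (\<lambda>e. - r e) w \<Longrightarrow> codable S r w"
proof -
  assume "codable S (\<lambda>e. - r e) w"
  then obtain l q where *: "\<forall>e\<in>S. 0 \<le> l e" "orbit_coded (\<lambda>e. - center r S l e) l q w"
    unfolding codable_def center_uminus[abs_def] by blast
  then have "orbit_coded (center r S l) l (- q) w"
    using orbit_coded_uminus[of "center r S l" l "- q"] by simp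
  then show ?thesis using *(1) unfolding codable_def by blast
qed

text \<open>Additional letters get length 0, which leaves all centres in place.\<close>

lemma codable_mono:
  assumes "codable S r w" "S \<subseteq> S'" "set w \<subseteq> S" "finite S'"
  shows "codable S' r w"
proof -
  obtain l q where l: "\<forall>e\<in>S. 0 \<le> l e" "orbit_coded (center r S l) l q w"
    using assms(1) unfolding codable_def by blast
  define l' where "l' e = (if e \<in> S then l e else 0)" for e
  have "center r S' l' e = center r S l e" for e
    unfolding center_def using assms(2,4)
    by (intro arg_cong2[of _ _ _ _ "(/)"] sum.mono_neutral_cong_right) (auto simp: l'_def)
  then have "orbit_coded (center r S' l') l' q w \<longleftrightarrow> orbit_coded (center r S l) l q w"
    using assms(3) by (intro orbit_coded_cong) (auto simp: l'_def)
  moreover have "\<forall>e\<in>S'. 0 \<le> l' e" using l(1) by (simp add: l'_def)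
  ultimately show ?thesis using l(2) unfolding codable_def by blast
qed

context extreme_letters
begin

text \<open>A passage through \<open>a\<close> and then \<open>z\<close> translates by
  \<open>- 2 * c a - 2 * c z = d\<close>. The interval of \<open>a\<close> runs from
  \<open>(M - d) / 2\<close> to \<open>(M - d) / 2 + la\<close>, where \<open>M\<close> stands for
  the total length of the other letters. As \<open>d\<close> is nonnegative, it suffices to check
  the left end at the first visit and the right end at the last.\<close>

lemma orbit_coded_alt_word:
  assumes c: "c a = (lz + M) / 2" "c z = - (la + M) / 2" and l: "l a = la" "l z = lz"
    and d: "la = lz + d" "0 \<le> (d :: real)"
    and q: "(M - d) / 2 < q" "q + j * d < (M - d) / 2 + la"
  shows "orbit_coded c l q (alt_word a z j)"
  using q
proof (induction j arbitrary: q)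
  case 0
  then show ?case by (simp add: c l d abs_less_iff field_simps)
next
  case (Suc j)
  have jd: "0 \<le> j * d" using d by simp
  have s: "real (Suc j) * d = j * d + d" by (simp add: algebra_simps)
  have c2: "2 * c a = lz + M" "2 * c z = - la - M" using c by simp_all
  have bounds: "M - d < 2 * q" "2 * (q + d) < M - d + 2 * la"
    using Suc.prems jd unfolding s diff_divide_distrib by simp_all
  have 1: "\<bar>q - c a\<bar> < l a / 2" and 2: "\<bar>q - 2 * c a - c z\<bar> < l z / 2"
    using bounds d c2 unfolding l abs_less_iff by auto
  have eq: "q - 2 * c a - 2 * c z = q + d"
    unfolding c d by (simp add: field_simps)
  have "orbit_coded c l (q - 2 * c a - 2 * c z) (alt_word a z j)"
    unfolding eq using Suc.prems d unfolding s by (intro Suc.IH) auto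
  then show ?case using 1 2 by simp
qed

lemma sum_list_alt_word:
  "sum_list (map c (alt_word a z j)) = (real j + 1) * c a + real j * (c z :: real)"
  by (induction j) (auto simp: algebra_simps)

text \<open>The given lengths belong to the exchange induced on the middle interval of length
  \<open>M + d\<close>, which meets the interval of \<open>a\<close> in a strip of length
  \<open>d\<close>. On the left \<open>l' z\<close> of the strip \<open>k + 1\<close> passages
  through \<open>az\<close> fit, on the remaining \<open>l' a\<close> at least
  \<open>k\<close>.\<close>

lemma codable_block_subst:
  assumes cod: "codable S induced_rank w" and fin: "finite S" and wS: "set w \<subseteq> S"
  shows "codable S r (concat (map (block_subst a z k) w))"
proof -
  obtain l' q where l': "\<forall>e\<in>S. 0 \<le> l' e" and q: "orbit_coded (center induced_rank S l') l' q w"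
    using cod unfolding codable_def by blast
  \<comment> \<open>One passage translates by \<open>d\<close>, hence \<open>la = lz + d\<close>;
    \<open>lz\<close> is chosen so that \<open>k + 1\<close> passages carry the right end of the new
    \<open>z\<close> to that of the old \<open>a\<close>.\<close>
  define d where "d = l' a + l' z"
  define lz where "lz = k * d + l' z"
  define la where "la = lz + d"
  define l where "l = l'(a := la, z := lz)"
  define R where "R = S - {a, z}"
  define M where "M = (\<Sum>f\<in>R. l' f)"
  have l'a: "0 \<le> l' a" and l'z: "0 \<le> l' z" using l' aS zS by simp_all
  have d: "0 \<le> d" using l'a l'z by (simp add: d_def)
  have Rfin: "finite R" and SR: "S = insert a (insert z R)" and aR: "a \<notin> insert z R" and zR: "z \<notin> R"
    using fin aS zS az by (auto simp: R_def)
  have sumS: "(\<Sum>f\<in>S. h f) = h a + (h z + (\<Sum>f\<in>R. h f))" for h :: "'a \<Rightarrow> real"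
    unfolding SR using Rfin aR zR by simp
  have lR: "l f = l' f" if "f \<in> R" for f using that by (auto simp: l_def R_def)
  have RS: "r a < r f" "r f < r z" "induced_rank f = r f" if "f \<in> R" for f
    using that a_less[of f] less_z[of f] by (auto simp: R_def induced_rank_def)
  have raz: "r a < r z" using a_less[OF zS] az by auto
  have ir: "induced_rank a = r a - 1" "induced_rank z = r a" using az by (auto simp: induced_rank_def)
  have la: "l a = la" "l z = lz" using az by (auto simp: l_def)
  have c: "center r S l a = (lz + M) / 2" "center r S l z = - (la + M) / 2"
    unfolding center_def sumS la M_def using RS raz
    by (simp_all add: lR sum_negf)
  have c': "center induced_rank S l' a = (l' z + M) / 2" "center induced_rank S l' z = (M - l' a) / 2"
  proof -
    have sgn1: "sgn (induced_rank f - (r a - 1)) = 1" "sgn (induced_rank f - r a) = 1" if "f \<in> R" for f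
      using RS[OF that] by (simp_all add: sgn_if)
    then show "center induced_rank S l' a = (l' z + M) / 2" "center induced_rank S l' z = (M - l' a) / 2"
      unfolding center_def sumS M_def ir by simp_all
  qed
  \<comment> \<open>The old extremes contribute \<open>lz - la\<close> from opposite sides, the new
    ones \<open>- l' a - l' z\<close> from the same side; both equal \<open>- d\<close>.\<close>
  have cR: "center r S l e = center induced_rank S l' e" if e: "e \<in> R" for e
  proof -
    have "(\<Sum>f\<in>R. sgn (r f - r e) * l f) = (\<Sum>f\<in>R. sgn (induced_rank f - induced_rank e) * l' f)"
      using RS e lR by (intro sum.cong) auto
    then show ?thesis
      unfolding center_def sumS la ir using RS[OF e]
      by (simp add: la_def d_def)
  qed
  let ?c = "center r S l" and ?c' = "center induced_rank S l'"
  \<comment> \<open>The total translation must agree as well: the image of \<open>e\<close> moves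
    the point as the new letter \<open>e\<close> does, so the induction along \<open>w\<close> can
    continue.\<close>
  have step: "orbit_coded ?c l q (block_subst a z k e) \<and> sum_list (map ?c (block_subst a z k e)) = ?c' e"
    if e: "e \<in> S" and q: "\<bar>q - ?c' e\<bar> < l' e / 2" for q e
  proof -
    consider "e = a" | "e = z" | "e \<in> R" using e SR by blast
    then show ?thesis
    proof cases
      case 1
      have "l' z + M - l' a < 2 * q" "2 * q < l' z + M + l' a"
        using q unfolding 1 c' abs_less_iff add_divide_distrib by simp_all
      then have "(M - d) / 2 < q" "q + k * d < (M - d) / 2 + la"
        using l'a l'z unfolding la_def lz_def diff_divide_distrib by (simp_all add: d_def add_divide_distrib)
      then have "orbit_coded ?c l q (alt_word a z k)"
        by (rule orbit_coded_alt_word[OF c la la_def d])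
      moreover have "sum_list (map ?c (alt_word a z k)) = ?c' a"
        unfolding sum_list_alt_word c c' la_def lz_def d_def by (simp add: field_simps)
      ultimately show ?thesis unfolding 1 block_subst_def by simp
    next
      case 2
      have "M - l' a - l' z < 2 * q" "2 * q < M - l' a + l' z"
        using q unfolding 2 c' abs_less_iff diff_divide_distrib by simp_all
      then have "(M - d) / 2 < q" "q + Suc k * d < (M - d) / 2 + la"
        using l'a l'z unfolding la_def lz_def diff_divide_distrib by (simp_all add: d_def add_divide_distrib algebra_simps)
      then have "orbit_coded ?c l q (alt_word a z (Suc k))"
        by (rule orbit_coded_alt_word[OF c la la_def d])
      moreover have "sum_list (map ?c (alt_word a z (Suc k))) = ?c' z"
        unfolding sum_list_alt_word c c' la_def lz_def d_def by (simp add: field_simps)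
      ultimately show ?thesis unfolding 2 block_subst_def using az by (simp del: alt_word.simps)
    next
      case 3
      then show ?thesis using q lR[OF 3] cR[OF 3] zR aR by (auto simp: block_subst_def)
    qed
  qed
  have "orbit_coded ?c l q (concat (map (block_subst a z k) w))"
    using q wS
  proof (induction w arbitrary: q)
    case (Cons e w)
    then show ?case using step[of e q] by (simp add: orbit_coded_append)
  qed simp
  moreover have "0 \<le> l e" if "e \<in> S" for e
    using that l' d aS zS by (auto simp: l_def la_def lz_def)
  ultimately show ?thesis unfolding codable_def by blast
qed

end

section \<open>The dichotomy for the extreme letters and the induction on the length\<close>

text \<open>The condition for the empty word gives \<open>P1\<close> or \<open>Q2\<close>, and
  \<open>P2\<close> or \<open>Q1\<close>. The pairs \<open>P1\<close>, \<open>P2\<close> and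
  \<open>Q1\<close>, \<open>Q2\<close> are the two claims; in the mixed cases connectedness of
  \<open>w\<close> supplies a third property.\<close>

lemma adjacent_extremes_dichotomy:
  assumes ext: "extreme_letters r (set w) a z" and oc: "sym_order_cond r w"
  shows "isolated_by a z w \<or> isolated_by z a w"
proof -
  interpret extreme_letters r "set w" a z by (rule ext)
  define P1 P2 Q1 Q2 where "P1 \<longleftrightarrow> (\<forall>x. sublist [x, z] w \<longrightarrow> x = a)"
    and "P2 \<longleftrightarrow> (\<forall>y. sublist [z, y] w \<longrightarrow> y = a)"
    and "Q1 \<longleftrightarrow> (\<forall>x. sublist [x, a] w \<longrightarrow> x = z)"
    and "Q2 \<longleftrightarrow> (\<forall>y. sublist [a, y] w \<longrightarrow> y = z)"
  note PQ = P1_def P2_def Q1_def Q2_def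
  have oc2: "r x < r x' \<longleftrightarrow> r y' < r y"
    if "sublist [x, y] w" "sublist [x', y'] w" "x \<noteq> x'" "y \<noteq> y'" for x y x' y'
    using sym_order_condD[OF oc, of x "[]" y x' y'] that by simp
  have in2: "x \<in> set w \<and> y \<in> set w" if "sublist [x, y] w" for x y
    using set_mono_sublist[OF that] by simp
  have "P1 \<or> Q2"
  proof (rule ccontr)
    assume "\<not> (P1 \<or> Q2)"
    then obtain x y where *: "sublist [x, z] w" "x \<noteq> a" "sublist [a, y] w" "y \<noteq> z" unfolding PQ by blast
    then show False using oc2[OF *(3,1)] a_less[of x] max[of y] in2[OF *(1)] in2[OF *(3)] by force
  qed
  moreover have "P2 \<or> Q1"
  proof (rule ccontr)
    assume "\<not> (P2 \<or> Q1)"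
    then obtain x y where *: "sublist [z, y] w" "y \<noteq> a" "sublist [x, a] w" "x \<noteq> z" unfolding PQ by blast
    then show False using oc2[OF *(3,1)] less_z[of x] min[of y] in2[OF *(1)] in2[OF *(3)] by force
  qed
  moreover have "sublist [w ! i, w ! Suc i] w" if "Suc i < length w" for i
  proof -
    have "w = take i w @ [w ! i, w ! Suc i] @ drop (Suc (Suc i)) w"
      using that by (simp add: Cons_nth_drop_Suc)
    then show ?thesis by (metis sublist_appendI)
  qed
  note adj = this
  have pos: "\<exists>i. Suc i < length w \<and> w ! i = x \<and> w ! Suc i = y" if xy: "sublist [x, y] w" for x y
  proof -
    obtain ps ss where "w = ps @ [x, y] @ ss" using xy unfolding sublist_def by blast
    then show ?thesis by (intro exI[of _ "length ps"]) (simp add: nth_append)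
  qed
  \<comment> \<open>Under \<open>P1\<close> and \<open>Q1\<close> all letters before an extreme
    letter are extreme. So the earlier of two violating positions is followed by an extreme letter,
    which must repeat the one before it, against \<open>P1\<close> or \<open>Q1\<close>.\<close>
  have "P2 \<or> Q2" if "P1" "Q1"
  proof (rule ccontr)
    assume "\<not> (P2 \<or> Q2)"
    then obtain y y' where "sublist [z, y] w" "y \<noteq> a" "sublist [a, y'] w" "y' \<noteq> z" unfolding PQ by blast
    then obtain i j where i: "Suc i < length w" "w ! i = z" "w ! Suc i \<noteq> a"
      and j: "Suc j < length w" "w ! j = a" "w ! Suc j \<noteq> z" using pos by metis
    have backward: "m \<le> n \<Longrightarrow> n < length w \<Longrightarrow> w ! n \<in> {a, z} \<Longrightarrow> w ! m \<in> {a, z}" for m n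
    proof (induction rule: inc_induct)
      case (step m)
      then show ?case using adj[of m] \<open>P1\<close> \<open>Q1\<close> unfolding PQ by (metis insert_iff order.strict_trans1 Suc_leI empty_iff)
    qed
    consider "i = j" | "Suc i \<le> j" | "Suc j \<le> i" by linarith
    then show False
    proof cases
      case 1 then show ?thesis using i j az by simp
    next
      case 2
      then have "w ! Suc i \<in> {a, z}" using backward[of "Suc i" j] j by simp
      then show ?thesis using i adj[of i] \<open>P1\<close> az unfolding PQ by auto
    next
      case 3
      then have "w ! Suc j \<in> {a, z}" using backward[of "Suc j" i] i by simp
      then show ?thesis using j adj[of j] \<open>Q1\<close> az unfolding PQ by auto
    qed
  qed
  \<comment> \<open>The same argument in the other reading direction.\<close>
  moreover have "P1 \<or> Q1" if "P2" "Q2"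
  proof (rule ccontr)
    assume "\<not> (P1 \<or> Q1)"
    then obtain x x' where "sublist [x, z] w" "x \<noteq> a" "sublist [x', a] w" "x' \<noteq> z" unfolding PQ by blast
    then obtain i j where i: "Suc i < length w" "w ! Suc i = z" "w ! i \<noteq> a"
      and j: "Suc j < length w" "w ! Suc j = a" "w ! j \<noteq> z" using pos by metis
    have forward: "m \<le> n \<Longrightarrow> n < length w \<Longrightarrow> w ! m \<in> {a, z} \<Longrightarrow> w ! n \<in> {a, z}" for m n
    proof (induction rule: dec_induct)
      case (step n)
      then show ?case using adj[of n] \<open>P2\<close> \<open>Q2\<close> unfolding PQ by (metis Suc_lessD insert_iff empty_iff)
    qed
    consider "i = j" | "Suc i \<le> j" | "Suc j \<le> i" by linarith
    then show False
    proof cases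
      case 1 then show ?thesis using i j az by simp
    next
      case 2
      then have "w ! j \<in> {a, z}" using forward[of "Suc i" j] i j by simp
      then show ?thesis using j adj[of j] \<open>Q2\<close> az unfolding PQ by auto
    next
      case 3
      then have "w ! i \<in> {a, z}" using forward[of "Suc j" i] i j by simp
      then show ?thesis using i adj[of i] \<open>P2\<close> az unfolding PQ by auto
    qed
  qed
  ultimately show ?thesis unfolding isolated_by_def PQ by blast
qed

text \<open>Rank and alphabet vary in the induction: the shorter word satisfies the condition for
  \<open>induced_rank\<close>, and the alphabet is cut down to \<open>set w\<close> so that its
  extreme letters occur.\<close>

lemma sym_order_cond_codable:
  assumes "finite S" "set w \<subseteq> S" "inj_on r S" "sym_order_cond r w"
  shows "codable S r w"
  using assms
proof (induction "length w" arbitrary: w r S rule: less_induct)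
  case less
  show ?case
  proof (cases "\<exists>e. set w \<subseteq> {e}")
    case True
    then obtain e where e: "set w \<subseteq> {e}" by blast
    \<comment> \<open>A single letter has centre 0, and the point 0 stays fixed.\<close>
    have "orbit_coded (center r {e} (\<lambda>_. 1)) (\<lambda>_. 1) 0 u" if "set u \<subseteq> {e}" for u
      using that by (induction u) (auto simp: center_def)
    then have "codable {e} r w" unfolding codable_def using e by (intro exI[of _ "\<lambda>_. 1"] exI[of _ 0]) auto
    then have "codable (insert e S) r w"
      using codable_mono[of "{e}" r w "insert e S"] e less.prems(1) by auto
    then show ?thesis
    proof (cases "w = []")
      case True
      then show ?thesis unfolding codable_def by (auto intro: exI[of _ "\<lambda>_. 0"])
    next
      case False
      then have "e \<in> S" using e less.prems(2) by (cases w) auto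
      then show ?thesis using \<open>codable (insert e S) r w\<close> by (simp add: insert_absorb)
    qed
  next
    case False
    have ne: "set w \<noteq> {}" using False by auto
    obtain a where a: "a \<in> set w" "r a = Min (r ` set w)" using Min_in[of "r ` set w"] ne by fastforce
    obtain z where z: "z \<in> set w" "r z = Max (r ` set w)" using Max_in[of "r ` set w"] ne by fastforce
    have injw: "inj_on r (set w)" using less.prems inj_on_subset by blast
    have bounds: "r a \<le> r e" "r e \<le> r z" if "e \<in> set w" for e using that a z by simp_all
    have az: "a \<noteq> z"
    proof
      assume "a = z"
      then have "r e = r a" if "e \<in> set w" for e using bounds[OF that] by simp
      then have "set w \<subseteq> {a}" using inj_onD[OF injw] a(1) by blast
      then show False using False by blast
    qed
    have len: "2 \<le> length w"
      using False by (cases w; cases "tl w") auto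
    \<comment> \<open>Serves both halves of the dichotomy, with \<open>r\<close> and with
      \<open>- r\<close>.\<close>
    have main: "codable (set w) s w"
      if ext: "extreme_letters s (set w) b c" and iso: "isolated_by b c w" and oc: "sym_order_cond s w"
      for s b c
    proof -
      interpret extreme_letters s "set w" b c by (rule ext)
      obtain k w' where "sublist w (concat (map (block_subst b c k) w'))" "set w' \<subseteq> set w"
        "length w' < length w" "sym_order_cond induced_rank w'"
        using desubst[OF oc iso] zS len by blast
      then show ?thesis
        using less.hyps[of w' "set w" induced_rank] induced_rank_inj codable_block_subst codable_sublist by blast
    qed
    have ext: "extreme_letters r (set w) a z"
      by unfold_locales (use injw a z az bounds in auto)
    have ext': "extreme_letters (\<lambda>e. - r e) (set w) z a"
      by unfold_locales (use injw a z az bounds in \<open>auto simp: inj_on_def\<close>)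
    have "codable (set w) r w"
      using adjacent_extremes_dichotomy[OF ext less.prems(4)]
    proof
      assume "isolated_by a z w"
      then show ?thesis using main[OF ext] less.prems(4) by blast
    next
      assume "isolated_by z a w"
      then show ?thesis
        using main[OF ext'] sym_order_cond_uminus[OF less.prems(4) injw] codable_uminus by blast
    qed
    then show ?thesis using codable_mono less.prems(1,2) by blast
  qed
qed

section \<open>The interval exchange transformation\<close>

lemma eventually_orbit_coded:
  assumes C: "\<And>e. ((\<lambda>t. C t e) \<longlongrightarrow> c e) F" and L: "\<And>e. ((\<lambda>t. L t e) \<longlongrightarrow> l e) F"
    and "(Q \<longlongrightarrow> q) F" "orbit_coded c l q w"
  shows "\<forall>\<^sub>F t in F. orbit_coded (C t) (L t) (Q t) w"
  using assms(3,4)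
proof (induction w arbitrary: q Q)
  case (Cons e w)
  have "((\<lambda>t. L t e / 2 - \<bar>Q t - C t e\<bar>) \<longlongrightarrow> l e / 2 - \<bar>q - c e\<bar>) F"
    by (intro tendsto_intros C L Cons.prems) simp
  then have "\<forall>\<^sub>F t in F. 0 < L t e / 2 - \<bar>Q t - C t e\<bar>"
    by (rule order_tendstoD) (use Cons.prems in simp)
  moreover have "((\<lambda>t. Q t - 2 * C t e) \<longlongrightarrow> q - 2 * c e) F"
    by (intro tendsto_intros C Cons.prems)
  then have "\<forall>\<^sub>F t in F. orbit_coded (C t) (L t) (Q t - 2 * C t e) w"
    by (rule Cons.IH) (use Cons.prems in simp)
  ultimately show ?case by eventually_elim simp
qed simp

text \<open>All lengths are increased by the same small \<open>t\<close>; centres depend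
  continuously on the lengths, so the coding survives.\<close>

lemma codable_pos:
  assumes "codable S r w" "finite S"
  obtains l q where "\<And>e. e \<in> S \<Longrightarrow> 0 < l e" "orbit_coded (center r S l) l q w"
proof -
  obtain l q where l: "\<forall>e\<in>S. 0 \<le> l e" "orbit_coded (center r S l) l q w"
    using assms(1) unfolding codable_def by blast
  define L where "L t e = l e + t" for t e
  have L: "((\<lambda>t. L t e) \<longlongrightarrow> l e) (at_right 0)" for e
    unfolding L_def by (auto intro!: tendsto_eq_intros)
  have "((\<lambda>t. center r S (L t) e) \<longlongrightarrow> center r S l e) (at_right 0)" for e
    unfolding center_def by (intro tendsto_intros L) simp
  then have "\<forall>\<^sub>F t in at_right 0. orbit_coded (center r S (L t)) (L t) q w"
    using L l(2) by (intro eventually_orbit_coded[where Q = "\<lambda>_. q"]) auto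
  moreover have "\<forall>\<^sub>F t in at_right (0 :: real). 0 < t"
    by (rule eventually_at_right_less)
  ultimately have "\<forall>\<^sub>F t in at_right 0. orbit_coded (center r S (L t)) (L t) q w \<and> 0 < t"
    by eventually_elim simp
  then obtain t where "orbit_coded (center r S (L t)) (L t) q w" "0 < t"
    using eventually_happens[of _ "at_right (0 :: real)"] trivial_limit_at_right_real by blast
  then show ?thesis using that[of "L t" q] l(1) by (auto simp: L_def add_nonneg_pos)
qed

section \<open>The symmetric exchange with given lengths\<close>

definition letter_interval :: "('a \<Rightarrow> real) \<Rightarrow> 'a set \<Rightarrow> ('a \<Rightarrow> real) \<Rightarrow> 'a \<Rightarrow> real set" where
  "letter_interval r S l e = {center r S l e - l e / 2..<center r S l e + l e / 2}"

locale letter_lengths =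
  fixes r :: "'a \<Rightarrow> real" and S :: "'a set" and l :: "'a \<Rightarrow> real"
  assumes fin: "finite S" and ne: "S \<noteq> {}" and inj: "inj_on r S" and pos: "e \<in> S \<Longrightarrow> 0 < l e"
begin

abbreviation "total_length \<equiv> \<Sum>g\<in>S. l g"

text \<open>The \<open>sgn\<close> sum is twice the length ranked above \<open>e\<close>, minus the
  total, plus \<open>l e\<close>. So the intervals are stacked from the left in order of decreasing
  rank.\<close>

lemma interval_ends:
  assumes "e \<in> S"
  shows "center r S l e - l e / 2 = (\<Sum>g\<in>S. if r e < r g then l g else 0) - total_length / 2" (is ?L)
    and "center r S l e + l e / 2 = (\<Sum>g\<in>S. if r e \<le> r g then l g else 0) - total_length / 2" (is ?R)
proof -
  have "(\<Sum>g\<in>S. sgn (r g - r e) * l g) =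
      (\<Sum>g\<in>S. 2 * (if r e < r g then l g else 0) - l g + (if g = e then l g else 0))"
    using inj_on_eq_iff[OF inj _ assms] by (intro sum.cong) (auto simp: sgn_if)
  also have "\<dots> = 2 * (\<Sum>g\<in>S. if r e < r g then l g else 0) - total_length + l e"
    using fin assms by (simp add: sum.distrib sum_subtractf sum_distrib_left)
  finally show L: ?L unfolding center_def by (simp add: field_simps)
  have "(\<Sum>g\<in>S. if r e \<le> r g then l g else 0) =
      (\<Sum>g\<in>S. (if r e < r g then l g else 0) + (if g = e then l g else 0))"
    using inj_on_eq_iff[OF inj _ assms] inj_on_eq_iff[OF inj assms] by (intro sum.cong) auto
  also have "\<dots> = (\<Sum>g\<in>S. if r e < r g then l g else 0) + l e"
    using fin assms by (simp add: sum.distrib)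
  finally show ?R using L by (simp add: field_simps)
qed

lemma interval_gap:
  assumes "e \<in> S" "f \<in> S" "r e < r f"
  shows "center r S l f + l f / 2 \<le> center r S l e - l e / 2"
  unfolding interval_ends[OF assms(1)] interval_ends[OF assms(2)]
  using assms(3) pos by (intro diff_right_mono sum_mono) (auto intro: less_imp_le)

lemma strictly_left_iff:
  assumes "e \<in> S" "f \<in> S"
  shows "strictly_left_of (letter_interval r S l e) (letter_interval r S l f) \<longleftrightarrow> r f < r e"
proof
  assume "r f < r e"
  then show "strictly_left_of (letter_interval r S l e) (letter_interval r S l f)"
    using interval_gap[OF assms(2,1)] unfolding strictly_left_of_def letter_interval_def by auto
next
  assume left: "strictly_left_of (letter_interval r S l e) (letter_interval r S l f)"
  have "center r S l e \<in> letter_interval r S l e" "center r S l f \<in> letter_interval r S l f"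
    using pos[OF assms(1)] pos[OF assms(2)] by (simp_all add: letter_interval_def)
  then have "center r S l e < center r S l f" using left unfolding strictly_left_of_def by blast
  then show "r f < r e"
    using interval_gap[OF assms] inj_on_eq_iff[OF inj assms] pos[OF assms(1)] pos[OF assms(2)]
    by (cases "r e" "r f" rule: linorder_cases) auto
qed

lemma disjoint_intervals: "disjoint_family_on (letter_interval r S l) S"
  unfolding disjoint_family_on_def
proof (intro ballI impI)
  fix e f assume "e \<in> S" "f \<in> S" "e \<noteq> f"
  then consider "r e < r f" | "r f < r e" using inj_on_eq_iff[OF inj] by fastforce
  then show "letter_interval r S l e \<inter> letter_interval r S l f = {}"
    using strictly_left_iff[of e f] strictly_left_iff[of f e] \<open>e \<in> S\<close> \<open>f \<in> S\<close>
    unfolding strictly_left_of_def by (metis disjoint_iff less_irrefl)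
qed

lemma Union_intervals: "(\<Union>e\<in>S. letter_interval r S l e) = {- (total_length / 2)..<total_length / 2}"
proof (intro equalityI subsetI)
  fix x assume "x \<in> (\<Union>e\<in>S. letter_interval r S l e)"
  then obtain e where e: "e \<in> S" "center r S l e - l e / 2 \<le> x" "x < center r S l e + l e / 2"
    by (auto simp: letter_interval_def)
  have "0 \<le> (\<Sum>g\<in>S. if r e < r g then l g else 0)"
    using pos by (intro sum_nonneg) (auto intro: less_imp_le)
  moreover have "(\<Sum>g\<in>S. if r e \<le> r g then l g else 0) \<le> total_length"
    using pos by (intro sum_mono) (auto intro: less_imp_le)
  ultimately show "x \<in> {- (total_length / 2)..<total_length / 2}" using e interval_ends[OF e(1)] by simp
next
  fix x assume x: "x \<in> {- (total_length / 2)..<total_length / 2}"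
  define E where "E = {e \<in> S. center r S l e - l e / 2 \<le> x}"
  have "E \<noteq> {}"
  proof -
    obtain e where e: "e \<in> S" "r e = Max (r ` S)" using Max_in[of "r ` S"] fin ne by fastforce
    have "r g \<le> r e" if "g \<in> S" for g unfolding e(2) using fin that by simp
    then have "(\<Sum>g\<in>S. if r e < r g then l g else 0) = 0"
      by (intro sum.neutral ballI) (simp add: not_less[symmetric])
    then show ?thesis using interval_ends(1)[OF e(1)] x e(1) by (auto simp: E_def)
  qed
  moreover have "finite E" using fin by (simp add: E_def)
  \<comment> \<open>Among the intervals starting at or before \<open>x\<close>, the one of lowest
    rank starts last. The next letter below it, if any, starts where this one ends and is not in
    \<open>E\<close>.\<close>
  ultimately obtain e where e: "e \<in> E" "r e = Min (r ` E)" using Min_in[of "r ` E"] by fastforce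
  have eS: "e \<in> S" and le: "center r S l e - l e / 2 \<le> x" using e(1) by (auto simp: E_def)
  have "x < center r S l e + l e / 2"
  proof (cases "\<exists>f\<in>S. r f < r e")
    case True
    define B where "B = {f \<in> S. r f < r e}"
    have "B \<noteq> {}" "finite B" using True fin by (auto simp: B_def)
    then obtain f where f: "f \<in> B" "r f = Max (r ` B)" using Max_in[of "r ` B"] by fastforce
    have fS: "f \<in> S" "r f < r e" using f(1) by (auto simp: B_def)
    have "r g \<le> r f" if "g \<in> S" "r g < r e" for g
      unfolding f(2) using that \<open>finite B\<close> by (simp add: B_def)
    then have "r f < r g \<longleftrightarrow> r e \<le> r g" if "g \<in> S" for g
      using that fS(2) by (meson leD le_less_trans not_le less_le_trans)
    then have "center r S l f - l f / 2 = center r S l e + l e / 2"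
      unfolding interval_ends[OF fS(1)] interval_ends[OF eS] by (intro arg_cong2[of _ _ _ _ "(-)"] sum.cong) auto
    moreover have "f \<notin> E" using fS(2) e(2) Min_le[of "r ` E" "r f"] \<open>finite E\<close> by fastforce
    ultimately show ?thesis using fS(1) by (auto simp: E_def)
  next
    case False
    then have "(\<Sum>g\<in>S. if r e \<le> r g then l g else 0) = total_length" by (intro sum.cong) auto
    then show ?thesis using interval_ends(2)[OF eS] x by simp
  qed
  then show "x \<in> (\<Union>e\<in>S. letter_interval r S l e)" using eS le by (auto simp: letter_interval_def)
qed

definition exchange :: "real \<Rightarrow> real" where
  "exchange x = x - 2 * center r S l (THE e. e \<in> S \<and> x \<in> letter_interval r S l e)"

lemma exchange_eq:
  assumes "e \<in> S" "x \<in> letter_interval r S l e"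
  shows "exchange x = x - 2 * center r S l e"
proof -
  have "(THE f. f \<in> S \<and> x \<in> letter_interval r S l f) = e"
    using assms disjoint_intervals unfolding disjoint_family_on_def by (intro the_equality) auto
  then show ?thesis by (simp add: exchange_def)
qed

lemma letter_lengths_uminus: "letter_lengths (\<lambda>e. - r e) S l"
  using fin ne inj pos by unfold_locales (auto simp: inj_on_def)

text \<open>The translation reflects the centre at 0, giving the interval of \<open>e\<close> for
  the rank \<open>- r\<close>. Partition and order of the images thus come from the same locale at
  \<open>- r\<close>.\<close>

lemma exchange_image:
  assumes "e \<in> S"
  shows "exchange ` letter_interval r S l e = letter_interval (\<lambda>e. - r e) S l e"
proof -
  have "exchange ` letter_interval r S l e = (\<lambda>x. - 2 * center r S l e + x) ` letter_interval r S l e"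
    using exchange_eq[OF assms] by (intro image_cong) auto
  also have "\<dots> = letter_interval (\<lambda>e. - r e) S l e"
    unfolding letter_interval_def center_uminus image_add_atLeastLessThan by simp
  finally show ?thesis .
qed

lemma exchange_standard_iet:
  "standard_iet S {- (total_length / 2)..<total_length / 2} (letter_interval r S l) exchange"
proof -
  interpret neg: letter_lengths "\<lambda>e. - r e" S l by (rule letter_lengths_uminus)
  have "0 < total_length" using pos fin ne by (intro sum_pos)
  then have "half_open_interval {- (total_length / 2)..<total_length / 2}"
    unfolding half_open_interval_def by (intro exI[of _ "- (total_length / 2)"] exI[of _ "total_length / 2"]) simp
  moreover have "half_open_interval (letter_interval r S l e)" if "e \<in> S" for e
    unfolding half_open_interval_def letter_interval_def
    using pos[OF that] by (intro exI[of _ "center r S l e - l e / 2"] exI[of _ "center r S l e + l e / 2"]) simp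
  moreover have "\<exists>t. \<forall>x\<in>letter_interval r S l e. exchange x = x + t" if "e \<in> S" for e
    using exchange_eq[OF that] by (intro exI[of _ "- 2 * center r S l e"]) simp
  moreover have "disjoint_family_on (\<lambda>e. exchange ` letter_interval r S l e) S"
    using neg.disjoint_intervals exchange_image unfolding disjoint_family_on_def by simp
  ultimately show ?thesis
    using disjoint_intervals Union_intervals neg.Union_intervals exchange_image
    unfolding standard_iet_def by simp
qed

lemma exchange_orders:
  assumes "e \<in> S" "f \<in> S"
  shows "iet_order_D (letter_interval r S l) e f \<longleftrightarrow> r f < r e"
    and "iet_order_A (letter_interval r S l) exchange e f \<longleftrightarrow> r e < r f"
proof -
  interpret neg: letter_lengths "\<lambda>e. - r e" S l by (rule letter_lengths_uminus)
  show "iet_order_D (letter_interval r S l) e f \<longleftrightarrow> r f < r e"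
    unfolding iet_order_D_def using strictly_left_iff[OF assms] .
  show "iet_order_A (letter_interval r S l) exchange e f \<longleftrightarrow> r e < r f"
    unfolding iet_order_A_def exchange_image[OF assms(1)] exchange_image[OF assms(2)]
    using neg.strictly_left_iff[OF assms] by simp
qed

lemma orbit_coded_exchange:
  assumes "orbit_coded (center r S l) l q w" "set w \<subseteq> S" "i < length w"
  shows "(exchange ^^ i) q \<in> letter_interval r S l (w ! i)"
  using assms
proof (induction w arbitrary: q i)
  case (Cons e w)
  have "\<bar>q - center r S l e\<bar> < l e / 2" using Cons.prems(1) by simp
  then have q: "q \<in> letter_interval r S l e" unfolding letter_interval_def abs_less_iff by simp
  show ?case
  proof (cases i)
    case 0 then show ?thesis using q by simp
  next
    case (Suc j)
    then have "(exchange ^^ i) q = (exchange ^^ j) (exchange q)" by (simp add: funpow_swap1)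
    then show ?thesis
      using Cons.IH[of "q - 2 * center r S l e" j] Cons.prems Suc exchange_eq[OF _ q] by simp
  qed
qed simp

end

section \<open>Orbits and the order condition for codings\<close>

lemma standard_iet_image:
  assumes "standard_iet A I J T"
  shows "T ` I = I"
proof -
  have "(\<Union>e\<in>A. J e) = I" "(\<Union>e\<in>A. T ` J e) = I" using assms unfolding standard_iet_def by simp_all
  then show ?thesis by (metis image_UN)
qed

lemma int_iterate_in:
  assumes "T ` I = I" "x \<in> I"
  shows "int_iterate I T n x \<in> I"
proof -
  have "(T ^^ m) x \<in> I" "(inv_into I T ^^ m) x \<in> I" for m
    using assms by (induction m) (auto intro: inv_into_into)
  then show ?thesis by (simp add: int_iterate_def)
qed

lemma int_iterate_Suc:
  assumes "T ` I = I" "x \<in> I"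
  shows "int_iterate I T (n + 1) x = T (int_iterate I T n x)"
proof (cases "0 \<le> n")
  case True
  then have "nat (n + 1) = Suc (nat n)" by simp
  then show ?thesis using True by (simp add: int_iterate_def)
next
  case False
  define m where "m = nat (- (n + 1))"
  have m: "nat (- n) = Suc m" using False by (simp add: m_def)
  \<comment> \<open>For \<open>n = - 1\<close> the left side falls under the nonnegative branch;
    both iterates are then the identity.\<close>
  have 1: "int_iterate I T (n + 1) x = (inv_into I T ^^ m) x"
    using False by (cases "n = - 1") (auto simp: int_iterate_def m_def)
  have "int_iterate I T n x = inv_into I T (int_iterate I T (n + 1) x)"
    using False unfolding 1 by (simp add: int_iterate_def m)
  moreover have "int_iterate I T (n + 1) x \<in> T ` I" using int_iterate_in[OF assms] assms(1) by simp
  ultimately show ?thesis by (simp add: f_inv_into_f)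
qed

lemma trajectory_exists:
  assumes iet: "standard_iet A I J T" and x: "x \<in> I"
  shows "\<exists>s. is_trajectory A I J T x s"
proof -
  have J: "disjoint_family_on J A" "(\<Union>e\<in>A. J e) = I" using iet unfolding standard_iet_def by simp_all
  have "\<exists>e\<in>A. int_iterate I T n x \<in> J e" for n
    using int_iterate_in[OF standard_iet_image[OF iet] x, of n] J(2) by blast
  then obtain s where "\<And>n. s n \<in> A" "\<And>n. int_iterate I T n x \<in> J (s n)" by metis
  then have "is_trajectory A I J T x s"
    using J(1) unfolding is_trajectory_def disjoint_family_on_def by (metis disjoint_iff)
  then show ?thesis by blast
qed

text \<open>\<open>ltA\<close> compares the orbit points just after leaving the intervals of
  \<open>x\<close> and \<open>x'\<close>, \<open>ltD\<close> those reached after \<open>v\<close>.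
  In between both undergo the same translations, so their difference is constant.\<close>

lemma natural_coding_order_condition:
  assumes iet: "standard_iet A I J T" and ord: "iet_has_orders A J T ltA ltD"
    and tot: "totalp_on A ltA" "totalp_on A ltD"
    and w: "set w \<subseteq> A" "w \<in> natural_coding A I J T"
  shows "order_condition (factors w) ltA ltD"
  unfolding order_condition_def word_order_condition_def
proof (intro allI impI, elim conjE)
  fix v x x' y y'
  assume f: "x # v @ [y] \<in> factors w" "x' # v @ [y'] \<in> factors w" and ne: "x \<noteq> x'" "y \<noteq> y'"
  obtain x0 s k where x0: "x0 \<in> I" and tr: "is_trajectory A I J T x0 s"
    and ws: "\<And>i. i < length w \<Longrightarrow> w ! i = s (k + int i)"
    using w(2) unfolding natural_coding_def by blast
  define P where "P n = int_iterate I T n x0" for n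
  have PJ: "P n \<in> J (s n)" for n using tr unfolding is_trajectory_def P_def by blast
  have PS: "P (n + 1) = T (P n)" for n
    unfolding P_def by (rule int_iterate_Suc[OF standard_iet_image[OF iet] x0])
  have visit: "\<exists>n. P n \<in> J b \<and> (\<forall>i<length v. P (n + 1 + int i) \<in> J (v ! i)) \<and> P (n + 1 + int (length v)) \<in> J c"
    if bc: "b # v @ [c] \<in> factors w" for b c
  proof -
    obtain ps ss where dec: "w = ps @ (b # v @ [c]) @ ss"
      using bc unfolding factors_def sublist_def by blast
    define n where "n = k + int (length ps)"
    have nth: "P (n + int i) \<in> J ((b # v @ [c]) ! i)" if "i < length v + 2" for i
    proof -
      have "w ! (length ps + i) = ((b # v @ [c]) @ ss) ! i"
        unfolding dec by (rule nth_append_length_plus)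
      also have "\<dots> = (b # v @ [c]) ! i" using that by (subst nth_append) simp
      finally have "w ! (length ps + i) = (b # v @ [c]) ! i" .
      moreover have "w ! (length ps + i) = s (n + int i)"
        using ws[of "length ps + i"] that unfolding dec n_def by (simp add: algebra_simps)
      ultimately show ?thesis using PJ by metis
    qed
    have "P n \<in> J b" using nth[of 0] by simp
    moreover have "P (n + 1 + int i) \<in> J (v ! i)" if "i < length v" for i
      using nth[of "Suc i"] that by (simp add: nth_append algebra_simps)
    moreover have "P (n + 1 + int (length v)) \<in> J c"
      using nth[of "Suc (length v)"] by (simp add: nth_append algebra_simps)
    ultimately show ?thesis by blast
  qed
  obtain n where n: "P n \<in> J x" "\<And>i. i < length v \<Longrightarrow> P (n + 1 + int i) \<in> J (v ! i)"
    "P (n + 1 + int (length v)) \<in> J y" using visit[OF f(1)] by blast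
  obtain n' where n': "P n' \<in> J x'" "\<And>i. i < length v \<Longrightarrow> P (n' + 1 + int i) \<in> J (v ! i)"
    "P (n' + 1 + int (length v)) \<in> J y'" using visit[OF f(2)] by blast
  have inA: "x \<in> A" "x' \<in> A" "y \<in> A" "y' \<in> A" "set v \<subseteq> A"
    using f w(1) set_mono_sublist[of "x # v @ [y]" w] set_mono_sublist[of "x' # v @ [y']" w]
    unfolding factors_def by auto
  have diff: "P (n + 1 + int i) - P (n' + 1 + int i) = P (n + 1) - P (n' + 1)" if "i \<le> length v" for i
    using that
  proof (induction i)
    case (Suc i)
    have "v ! i \<in> A" using inA(5) Suc.prems by (simp add: subset_iff)
    moreover have "\<forall>e\<in>A. \<exists>t. \<forall>p\<in>J e. T p = p + t"
      using iet unfolding standard_iet_def by (elim conjE)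
    ultimately obtain t where t: "\<And>p. p \<in> J (v ! i) \<Longrightarrow> T p = p + t" by blast
    have "P (n + 1 + int (Suc i)) = P (n + 1 + int i) + t" "P (n' + 1 + int (Suc i)) = P (n' + 1 + int i) + t"
      using PS[of "n + 1 + int i"] PS[of "n' + 1 + int i"] t[OF n(2)] t[OF n'(2)] Suc.prems
      by (simp_all add: algebra_simps)
    then show ?case using Suc by simp
  qed simp
  have left: "P (n + 1) < P (n' + 1)" if "ltA x x'" "P n \<in> J x" "P n' \<in> J x'" "x \<in> A" "x' \<in> A" for x x' n n'
    using that ord unfolding PS iet_has_orders_def iet_order_A_def strictly_left_of_def by blast
  have right: "p < p'" if "ltD y y'" "p \<in> J y" "p' \<in> J y'" "y \<in> A" "y' \<in> A" for y y' p p'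
    using that ord unfolding iet_has_orders_def iet_order_D_def strictly_left_of_def by blast
  \<comment> \<open>Totality turns the one-sided facts into equivalences.\<close>
  have "ltA x x' \<longleftrightarrow> P (n + 1) < P (n' + 1)"
    using left[OF _ n(1) n'(1) inA(1,2)] left[OF _ n'(1) n(1) inA(2,1)] totalp_onD[OF tot(1) inA(1,2) ne(1)] by fastforce
  moreover have "ltD y y' \<longleftrightarrow> P (n + 1 + int (length v)) < P (n' + 1 + int (length v))"
    using right[OF _ n(3) n'(3) inA(3,4)] right[OF _ n'(3) n(3) inA(4,3)] totalp_onD[OF tot(2) inA(3,4) ne(2)] by fastforce
  ultimately show "ltA x x' \<longleftrightarrow> ltD y y'" using diff[of "length v"] by auto
qed

section \<open>From orders to ranks, and the equivalence\<close>

lemma strict_total_order_rank: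
  assumes "finite A" "strict_total_order_on A lt"
  shows "\<exists>r :: 'a \<Rightarrow> real. inj_on r A \<and> (\<forall>e\<in>A. \<forall>f\<in>A. r e < r f \<longleftrightarrow> lt e f)"
proof -
  define r where "r e = real (card {g \<in> A. lt g e})" for e
  have irr: "\<not> lt e e" if "e \<in> A" for e
    using that assms(2) unfolding strict_total_order_on_def by (meson irreflp_onD)
  have mono: "r e < r f" if "e \<in> A" "f \<in> A" "lt e f" for e f
  proof -
    have "{g \<in> A. lt g e} \<subset> {g \<in> A. lt g f}"
      using that irr assms(2) unfolding strict_total_order_on_def by (blast dest: transp_onD)
    then show ?thesis unfolding r_def using assms(1) by (simp add: psubset_card_mono)
  qed
  have tot: "lt e f \<or> lt f e" if "e \<in> A" "f \<in> A" "e \<noteq> f" for e f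
    using that assms(2) unfolding strict_total_order_on_def totalp_on_def by blast
  have "inj_on r A" using mono tot by (intro inj_onI) (metis less_irrefl)
  moreover have "r e < r f \<longleftrightarrow> lt e f" if "e \<in> A" "f \<in> A" for e f
    using mono tot that by (metis less_asym less_irrefl)
  ultimately show ?thesis by blast
qed

theorem theorem4:
  fixes w :: "'a list" and A :: "'a set"
    and ltA ltD :: "'a \<Rightarrow> 'a \<Rightarrow> bool"
  assumes "finite A" and "A \<noteq> {}" and "set w \<subseteq> A"
    and "strict_total_order_on A ltA" and "strict_total_order_on A ltD"
    and "reverse_orders_on A ltD ltA"
  shows "(\<exists>I J T. standard_iet A I J T \<and> symmetric_iet A J T \<and>
            iet_has_orders A J T ltA ltD \<and> w \<in> natural_coding A I J T)
         \<longleftrightarrow> order_condition (factors w) ltA ltD"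
proof
  assume "\<exists>I J T. standard_iet A I J T \<and> symmetric_iet A J T \<and>
            iet_has_orders A J T ltA ltD \<and> w \<in> natural_coding A I J T"
  then show "order_condition (factors w) ltA ltD"
    using natural_coding_order_condition assms(3-5) unfolding strict_total_order_on_def by blast
next
  assume oc: "order_condition (factors w) ltA ltD"
  obtain r :: "'a \<Rightarrow> real" where r: "inj_on r A" "\<And>e f. e \<in> A \<Longrightarrow> f \<in> A \<Longrightarrow> r e < r f \<longleftrightarrow> ltA e f"
    using strict_total_order_rank[OF assms(1,4)] by blast
  have rD: "ltD e f \<longleftrightarrow> r f < r e" if "e \<in> A" "f \<in> A" for e f
    using that r(2) assms(6) unfolding reverse_orders_on_def by blast
  have "sym_order_cond r w"
    unfolding sym_order_cond_def
  proof (intro allI impI, elim conjE)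
    fix x v y x' y'
    assume s: "sublist (x # v @ [y]) w" "sublist (x' # v @ [y']) w" and ne: "x \<noteq> x'" "y \<noteq> y'"
    have "sublist (b # v) w" "sublist (v @ [c]) w" if "sublist (b # v @ [c]) w" for b c
      using that sublist_order.order_trans[of _ "b # v @ [c]" w] sublist_append_rightI[of "b # v" "[c]"]
        sublist_append_leftI[of "v @ [c]" "[b]"] by simp_all
    then have "bispecial (factors w) v"
      using s ne unfolding bispecial_def factors_def by blast
    then have "ltA x x' \<longleftrightarrow> ltD y y'"
      using oc s ne unfolding order_condition_def word_order_condition_def factors_def by blast
    then show "r x < r x' \<longleftrightarrow> r y' < r y"
      using sublist_in_set[OF s(1)] sublist_in_set[OF s(2)] assms(3) r(2) rD by (simp add: subset_iff)
  qed
  then have "codable A r w" using sym_order_cond_codable assms(1,3) r(1) by blast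
  then obtain l q where l: "\<And>e. e \<in> A \<Longrightarrow> 0 < l e" and q: "orbit_coded (center r A l) l q w"
    using codable_pos assms(1) by blast
  interpret letter_lengths r A l
    using assms(1,2) r(1) l by unfold_locales
  let ?I = "{- (total_length / 2)..<total_length / 2}" and ?J = "letter_interval r A l"
  have "symmetric_iet A ?J exchange" "iet_has_orders A ?J exchange ltA ltD"
    unfolding symmetric_iet_def reverse_orders_on_def iet_has_orders_def
    using exchange_orders r(2) rD by auto
  moreover have "w \<in> natural_coding A ?I ?J exchange"
  proof -
    \<comment> \<open>For the empty word \<open>q\<close> is unconstrained and may lie outside the
      interval.\<close>
    define x where "x = (if w = [] then - (total_length / 2) else q)"
    have "0 < total_length" using l assms(1,2) by (intro sum_pos)
    have x: "(exchange ^^ i) x \<in> ?J (w ! i)" if "i < length w" for i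
      using orbit_coded_exchange[OF q assms(3) that] that by (auto simp: x_def)
    have "x \<in> ?I"
    proof (cases "w = []")
      case True then show ?thesis using \<open>0 < total_length\<close> by (simp add: x_def)
    next
      case False
      then have "w ! 0 \<in> A" "x \<in> ?J (w ! 0)" using x[of 0] assms(3) by (simp_all add: subset_iff)
      then have "x \<in> (\<Union>e\<in>A. ?J e)" by blast
      then show ?thesis unfolding Union_intervals .
    qed
    moreover obtain s where s: "is_trajectory A ?I ?J exchange x s"
      using trajectory_exists[OF exchange_standard_iet \<open>x \<in> ?I\<close>] by blast
    moreover have "w ! i = s (0 + int i)" if "i < length w" for i
    proof -
      have "int_iterate ?I exchange (0 + int i) x \<in> ?J (w ! i)" using x[OF that] by (simp add: int_iterate_def)
      moreover have "w ! i \<in> A" using that assms(3) by (simp add: subset_iff)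
      ultimately show ?thesis using s unfolding is_trajectory_def by metis
    qed
    ultimately show ?thesis unfolding natural_coding_def by blast
  qed
  ultimately show "\<exists>I J T. standard_iet A I J T \<and> symmetric_iet A J T \<and>
            iet_has_orders A J T ltA ltD \<and> w \<in> natural_coding A I J T"
    using exchange_standard_iet by blast
qed

end
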